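(* For every integer $n\geq 4$ we have $d(2,n)\geq \gamma\,(n-2)$, where \[ \beta=\frac{1}{\sqrt{21490}}+\sqrt{\frac{2}{\sqrt{3}}+\frac{1}{21490}},\qquad \gamma_2=\frac{3846}{2593\sqrt{647}-5823},\qquad \gamma=\frac{\sqrt{16\beta^2+\gamma_2^2}-\gamma_2}{8\beta^2}. \] Moreover, $3^{1/4}\cdot 2^{-3/2}>\gamma>0.45557>\frac{5}{11}$.
   Context: An integral point set in $m$-dimensional Euclidean space is a finite set $M\subset\mathbb{R}^m$ such that all pairwise Euclidean distances between points of $M$ are integers and $M$ is not contained in any $(m-1)$-dimensional affine hyperplane. For integers $m\ge 2$, $n\ge m+1$, $d(m,n)$ denotes the minimum, over all integral point sets $M$ of exactly $n$ points in $\mathbb{R}^m$, of the diameter $\operatorname{diam}M=\max_{A,B\in M}|AB|$. *)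

theory Defs
  imports "HOL-Analysis.Analysis"
begin

definition integral_point_set :: "(real ^ 'm) set \<Rightarrow> bool" where
  "integral_point_set M \<longleftrightarrow>
     finite M \<and>
     (\<forall>A\<in>M. \<forall>B\<in>M. dist A B \<in> \<int>) \<and>
     \<not> (\<exists>H. affine H \<and> aff_dim H = int CARD('m) - 1 \<and> M \<subseteq> H)"

text \<open>
  The dimension \<open>m\<close> is passed as an index type: \<open>min_diameter TYPE('m) n\<close>, with \<open>CARD('m)\<close>
  playing the role of \<open>m\<close>, is \<open>d(m,n)\<close>. For a finite nonempty set the library's \<open>diameter\<close> is the
  maximum of the pairwise distances. \<open>LEAST\<close> ranges over the reals and is unspecified unless the
  minimum exists; it does exist as soon as there is an integral point set of \<open>n\<close> points, because
  diameters of such sets are natural numbers.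
\<close>
definition min_diameter :: "'m::finite itself \<Rightarrow> nat \<Rightarrow> real" where
  "min_diameter _ n =
     (LEAST r. \<exists>M :: (real ^ 'm) set. integral_point_set M \<and> card M = n \<and> diameter M = r)"

definition beta :: real where
  "beta = 1 / sqrt 21490 + sqrt (2 / sqrt 3 + 1 / 21490)"

definition gamma2 :: real where
  "gamma2 = 3846 / (2593 * sqrt 647 - 5823)"

definition gamma :: real where
  "gamma = (sqrt (16 * beta\<^sup>2 + gamma2\<^sup>2) - gamma2) / (8 * beta\<^sup>2)"

end

theory Submission
  imports Defs "HOL-Computational_Algebra.Polynomial"
begin

text \<open>
  Let \<open>p\<close> be the diameter of an integral point set \<open>M\<close> of \<open>n\<close> points, \<open>{A, B}\<close> a closest pair, at
  distance \<open>m\<^sub>1\<close>, and \<open>{C, D}\<close> a closest pair among the remaining pairs, at distance \<open>m\<^sub>2\<close>. By the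
  isodiametric inequality, applied to discs of radius \<open>m\<^sub>i / 2\<close> around the points
  (around all points but \<open>A\<close> for \<open>i = 2\<close>),
  \<open>n m\<^sub>1\<^sup>2 \<le> (p + m\<^sub>1)\<^sup>2\<close> and \<open>(n - 1) m\<^sub>2\<^sup>2 \<le> (p + m\<^sub>2)\<^sup>2\<close>. On the other hand a point off the line \<open>AB\<close>
  and off the perpendicular bisector of \<open>AB\<close> lies on one of \<open>m\<^sub>1 - 1\<close> hyperbolas with foci \<open>A, B\<close>,
  each of which meets the \<open>m\<^sub>2 - 1\<close> hyperbolas with foci \<open>C, D\<close>, the line \<open>CD\<close> and the bisector of
  \<open>CD\<close> in at most \<open>4 (m\<^sub>2 - 1) + 2 + 2\<close> points. So \<open>n \<le> 4 m\<^sub>2 (m\<^sub>1 - 1) + L\<^sub>1 + L\<^sub>2\<close>, where \<open>L\<^sub>1, L\<^sub>2\<close> count the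
  points on the two lines and \<open>m\<^sub>1 (L\<^sub>i - 1) \<le> p\<close>. These inequalities imply \<open>n - 2 \<le> 2.19 p\<close>
  (and \<open>\<gamma> \<le> 1/2.19\<close>) except for \<open>(p, m\<^sub>1) = (6, 2), (15, 3), (28, 4)\<close> with \<open>m\<^sub>1 = m\<^sub>2\<close> and some
  \<open>L\<^sub>i = 2 m\<^sub>1\<close>; there the points on a line would form an arithmetic progression of \<open>2 m\<^sub>1\<close> terms
  spaced by \<open>m\<^sub>1\<close>, which is impossible for points at integral distances from a point off the line.
\<close>

subsection \<open>Packing via the isodiametric inequality\<close>

text \<open>The hulls of \<open>A\<close> and \<open>B\<close> have total length
  \<open>(Sup A - Inf B) + (Sup B - Inf A)\<close>, and each bracket is at most \<open>h\<close>.
  This is the one-dimensional core of the fact that symmetrisation does not increase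
  distances.\<close>

lemma emeasure_sum_le_of_dist_le:
  fixes A B :: "real set"
  assumes "A \<in> sets borel" "B \<in> sets borel" and ne: "A \<noteq> {}" "B \<noteq> {}"
    and h: "\<And>a b. a \<in> A \<Longrightarrow> b \<in> B \<Longrightarrow> \<bar>a - b\<bar> \<le> h"
  shows "emeasure lborel A + emeasure lborel B \<le> ennreal (2 * h)"
proof -
  obtain a0 b0 where ab: "a0 \<in> A" "b0 \<in> B" using ne by blast
  have bA: "bdd_above A" "bdd_below A"
    using h[OF _ ab(2)] by (auto intro!: bdd_aboveI[of _ "b0 + h"] bdd_belowI[of _ "b0 - h"] simp: abs_le_iff) (force+)
  have bB: "bdd_above B" "bdd_below B"
    using h[OF ab(1)] by (auto intro!: bdd_aboveI[of _ "a0 + h"] bdd_belowI[of _ "a0 - h"] simp: abs_le_iff) (force+)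
  have 1: "Sup A \<le> Inf B + h"
  proof (rule cSup_least[OF ne(1)])
    fix a assume a: "a \<in> A"
    have "a - h \<le> Inf B" by (rule cInf_greatest[OF ne(2)]) (use h[OF a] in \<open>force simp: abs_le_iff\<close>)
    then show "a \<le> Inf B + h" by simp
  qed
  have 2: "Sup B \<le> Inf A + h"
  proof (rule cSup_least[OF ne(2)])
    fix b assume b: "b \<in> B"
    have "b - h \<le> Inf A" by (rule cInf_greatest[OF ne(1)]) (use h[OF _ b] in \<open>force simp: abs_le_iff\<close>)
    then show "b \<le> Inf A + h" by simp
  qed
  have sA: "A \<subseteq> {Inf A..Sup A}" using bA by (auto intro: cInf_lower cSup_upper)
  have sB: "B \<subseteq> {Inf B..Sup B}" using bB by (auto intro: cInf_lower cSup_upper)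
  have iA: "Inf A \<le> Sup A" and iB: "Inf B \<le> Sup B" using ab sA sB by force+
  have "emeasure lborel A + emeasure lborel B
      \<le> emeasure lborel {Inf A..Sup A} + emeasure lborel {Inf B..Sup B}"
    by (intro add_mono emeasure_mono sA sB) auto
  also have "\<dots> = ennreal ((Sup A - Inf A) + (Sup B - Inf B))"
    using iA iB by (simp flip: ennreal_plus)
  also have "\<dots> \<le> ennreal (2 * h)" using 1 2 by (intro ennreal_leI) simp
  finally show ?thesis .
qed

text \<open>Steiner symmetrisation; the strict inequality discards the \<open>x\<close> with empty section.\<close>
definition symmetral :: "(real \<times> real) set \<Rightarrow> (real \<times> real) set" where
  "symmetral K = {(x, y). ennreal (2 * \<bar>y\<bar>) < emeasure lborel {t. (x, t) \<in> K}}"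

text \<open>Vertical sections become centred intervals of the same length, so Fubini preserves the
  area. Over the abscissae of two points of the symmetral, the sections of \<open>K\<close> have
  lengths above \<open>2 * |y1|\<close> and \<open>2 * |y2|\<close>, hence contain points whose
  ordinates differ by more than \<open>|y1| + |y2|\<close>.\<close>

lemma
  assumes K: "K \<in> sets borel" and d: "\<And>u v. u \<in> K \<Longrightarrow> v \<in> K \<Longrightarrow> dist u v \<le> d"
  shows sets_symmetral: "symmetral K \<in> sets borel"
    and emeasure_symmetral: "emeasure lborel (symmetral K) = emeasure lborel K"
    and dist_symmetral: "u \<in> symmetral K \<Longrightarrow> v \<in> symmetral K \<Longrightarrow> dist u v \<le> d"
proof -
  define l where "l x = emeasure lborel {t. (x, t) \<in> K}" for x
  have Kp: "K \<in> sets (lborel \<Otimes>\<^sub>M lborel)"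
    using K by (subst lborel_prod) simp
  have vim: "Pair x -` K = {t. (x, t) \<in> K}" for x by auto
  have lm: "l \<in> borel_measurable borel"
    using lborel.measurable_emeasure_Pair[OF Kp] unfolding l_def vim by simp
  have sec: "{t. (x, t) \<in> K} \<in> sets borel" for x
    using sets_Pair1[OF Kp, of x] by (simp add: vim)
  have S: "symmetral K = {z \<in> space borel. ennreal (2 * \<bar>snd z\<bar>) < l (fst z)}"
    by (auto simp: symmetral_def l_def)
  have m1: "(\<lambda>z::real\<times>real. ennreal (2 * \<bar>snd z\<bar>)) \<in> borel_measurable borel"
    by (simp add: borel_prod[symmetric])
  have m2: "(\<lambda>z::real\<times>real. l (fst z)) \<in> borel_measurable borel"
    unfolding borel_prod[symmetric] by (rule measurable_compose[OF measurable_fst lm])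
  show Sm: "symmetral K \<in> sets borel" unfolding S by (rule borel_measurable_less[OF m1 m2])
  \<comment> \<open>Comparing a section of \<open>K\<close> with itself bounds twice its length by
    \<open>2 * d\<close>.\<close>
  have fin: "l x < \<infinity>" for x
  proof (cases "{t. (x, t) \<in> K} = {}")
    case False
    have "\<bar>a - b\<bar> \<le> d" if "(x, a) \<in> K" "(x, b) \<in> K" for a b
      using d[OF that] by (simp add: dist_prod_def dist_real_def)
    then have "l x + l x \<le> ennreal (2 * d)"
      unfolding l_def using emeasure_sum_le_of_dist_le[OF sec sec False False] by auto
    then show ?thesis by (metis add_top ennreal_less_top infinity_ennreal_def le_less_trans less_top not_le top_greatest)
  qed (simp add: l_def)
  have len: "emeasure lborel {y. ennreal (2 * \<bar>y\<bar>) < l x} = l x" for x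
  proof -
    obtain r where r: "l x = ennreal r" "0 \<le> r" using fin[of x] by (cases "l x") auto
    have "{y. ennreal (2 * \<bar>y\<bar>) < l x} = {-(r/2)<..<r/2}"
      unfolding r(1) by (auto simp: ennreal_less_iff)
    then show ?thesis using r by simp
  qed
  have Sp: "symmetral K \<in> sets (lborel \<Otimes>\<^sub>M lborel)" using Sm by (subst lborel_prod) simp
  have vim2: "Pair x -` symmetral K = {y. ennreal (2 * \<bar>y\<bar>) < l x}" for x
    by (auto simp: symmetral_def l_def)
  have "emeasure (lborel \<Otimes>\<^sub>M lborel) (symmetral K) = (\<integral>\<^sup>+x. l x \<partial>lborel)"
    by (subst lborel.emeasure_pair_measure_alt[OF Sp]) (simp add: vim2 len)
  also have "\<dots> = emeasure (lborel \<Otimes>\<^sub>M lborel) K"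
    by (subst lborel.emeasure_pair_measure_alt[OF Kp]) (simp add: vim l_def[abs_def])
  finally show "emeasure lborel (symmetral K) = emeasure lborel K" by (simp add: lborel_prod)
  assume u: "u \<in> symmetral K" and v: "v \<in> symmetral K"
  obtain x1 y1 x2 y2 where uv: "u = (x1, y1)" "v = (x2, y2)" by fastforce
  let ?A = "{t. (x1, t) \<in> K}" and ?B = "{t. (x2, t) \<in> K}"
  have l1: "ennreal (2 * \<bar>y1\<bar>) < l x1" and l2: "ennreal (2 * \<bar>y2\<bar>) < l x2"
    using u v by (auto simp: uv symmetral_def l_def)
  have ne: "?A \<noteq> {}" "?B \<noteq> {}" using l1 l2 unfolding l_def by (metis emeasure_empty not_less_zero)+
  have "\<not> (\<forall>a\<in>?A. \<forall>b\<in>?B. \<bar>a - b\<bar> \<le> \<bar>y1\<bar> + \<bar>y2\<bar>)"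
  proof
    assume "\<forall>a\<in>?A. \<forall>b\<in>?B. \<bar>a - b\<bar> \<le> \<bar>y1\<bar> + \<bar>y2\<bar>"
    then have "l x1 + l x2 \<le> ennreal (2 * (\<bar>y1\<bar> + \<bar>y2\<bar>))"
      unfolding l_def by (intro emeasure_sum_le_of_dist_le sec ne) auto
    also have "\<dots> = ennreal (2 * \<bar>y1\<bar>) + ennreal (2 * \<bar>y2\<bar>)" by (simp flip: ennreal_plus add: algebra_simps)
    also have "\<dots> < l x1 + l x2" by (rule add_strict_mono[OF l1 l2])
    finally show False by simp
  qed
  then obtain a b where ab: "(x1, a) \<in> K" "(x2, b) \<in> K" "\<bar>y1\<bar> + \<bar>y2\<bar> < \<bar>a - b\<bar>" by force
  have "dist u v \<le> dist (x1, a) (x2, b)"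
    unfolding uv dist_prod_def dist_real_def using ab(3)
    by (auto intro!: real_sqrt_le_mono power_mono simp: abs_le_square_iff[symmetric])
  also have "\<dots> \<le> d" by (rule d[OF ab(1,2)])
  finally show "dist u v \<le> d" .
qed

text \<open>Symmetrising in both coordinates makes the set centrally symmetric, hence contained in a disc of
  radius \<open>d / 2\<close>.\<close>
theorem isodiametric:
  fixes K :: "(real \<times> real) set"
  assumes K: "K \<in> sets borel" and d: "\<And>u v. u \<in> K \<Longrightarrow> v \<in> K \<Longrightarrow> dist u v \<le> d" and d0: "0 \<le> d"
  shows "emeasure lborel K \<le> ennreal (pi * (d / 2)\<^sup>2)"
proof -
  \<comment> \<open>After the swap, the second symmetrisation acts on the other coordinate.\<close>
  define S where "S = prod.swap ` symmetral K"
  have Sv: "S = prod.swap -` symmetral K" by (auto simp: S_def)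
  have sw: "prod.swap \<in> borel_measurable (borel :: (real\<times>real) measure)"
    unfolding borel_prod[symmetric] prod.swap_def by measurable
  have Sm: "S \<in> sets borel" unfolding Sv
    using measurable_sets_borel[OF sw sets_symmetral[OF K d]] by simp
  have Sp: "S \<in> sets (lborel \<Otimes>\<^sub>M lborel)" using Sm by (subst lborel_prod) simp
  have Yp: "symmetral K \<in> sets (lborel \<Otimes>\<^sub>M lborel)" using sets_symmetral[OF K d] by (subst lborel_prod) simp
  have "emeasure (lborel \<Otimes>\<^sub>M lborel) S = emeasure (lborel \<Otimes>\<^sub>M lborel) (symmetral K)"
    by (subst lborel.emeasure_pair_measure_alt[OF Sp], subst lborel_pair.emeasure_pair_measure_alt2[OF Yp])
       (auto simp: Sv vimage_def)
  then have eS: "emeasure lborel S = emeasure lborel K"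
    using emeasure_symmetral[OF K d] by (simp add: lborel_prod)
  have dS: "dist u v \<le> d" if "u \<in> S" "v \<in> S" for u v
    using that dist_symmetral[OF K d, of "prod.swap u" "prod.swap v"]
    by (auto simp: Sv dist_prod_def prod.swap_def add.commute)
  \<comment> \<open>The symmetry gained first now concerns the abscissa and survives the second
    symmetrisation, so \<open>symmetral S\<close> is invariant under negation.\<close>
  have sec: "{t. (-x, t) \<in> S} = {t. (x, t) \<in> S}" for x
    by (auto simp: Sv symmetral_def)
  have sub: "symmetral S \<subseteq> cball 0 (d / 2)"
  proof
    fix z assume z: "z \<in> symmetral S"
    then have "-z \<in> symmetral S" by (cases z) (auto simp: symmetral_def sec)
    from dist_symmetral[OF Sm dS z this] have "norm (2 *\<^sub>R z) \<le> d"
      by (simp only: dist_norm scaleR_2) simp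
    then show "z \<in> cball 0 (d / 2)" by (simp add: dist_norm)
  qed
  have "emeasure lborel K = emeasure lborel (symmetral S)"
    using emeasure_symmetral[OF Sm dS] eS by simp
  also have "\<dots> \<le> emeasure lborel (cball (0::real\<times>real) (d / 2))"
    by (rule emeasure_mono[OF sub]) simp
  also have "\<dots> = ennreal (pi * (d / 2)\<^sup>2)"
    using emeasure_cball[of "d/2" "0::real\<times>real"] d0 by (simp add: unit_ball_vol_2 power2_eq_square)
  finally show ?thesis .
qed

text \<open>The discs of radius \<open>m / 2\<close> are disjoint and points of their union are at
  most \<open>p + m\<close> apart; the isodiametric inequality compares the areas. Pairs of reals
  are used because their Lebesgue measure is a product measure.\<close>

lemma packing_prod:
  fixes M :: "(real \<times> real) set"
  assumes fin: "finite M" and m: "0 < m" and p: "0 \<le> p"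
    and lo: "\<And>u v. u \<in> M \<Longrightarrow> v \<in> M \<Longrightarrow> u \<noteq> v \<Longrightarrow> m \<le> dist u v"
    and hi: "\<And>u v. u \<in> M \<Longrightarrow> v \<in> M \<Longrightarrow> dist u v \<le> p"
  shows "real (card M) * m\<^sup>2 \<le> (p + m)\<^sup>2"
proof -
  let ?K = "\<Union>u\<in>M. ball u (m / 2)"
  have dj: "disjoint_family_on (\<lambda>u. ball u (m / 2)) M"
    unfolding disjoint_family_on_def
  proof (intro ballI impI)
    fix u v assume uv: "u \<in> M" "v \<in> M" "u \<noteq> v"
    have False if "dist u z < m / 2" "dist v z < m / 2" for z
      using lo[OF uv] dist_triangle2[of u v z] that by linarith
    then show "ball u (m / 2) \<inter> ball v (m / 2) = {}" by (auto simp: disjoint_iff)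
  qed
  have "emeasure lborel ?K = (\<Sum>u\<in>M. emeasure lborel (ball u (m / 2)))"
    by (rule sym, rule sum_emeasure) (use fin dj in auto)
  also have "\<dots> = (\<Sum>u\<in>M. ennreal (pi * (m / 2)\<^sup>2))"
    using m by (intro sum.cong refl) (simp add: emeasure_ball unit_ball_vol_2 power2_eq_square)
  also have "\<dots> = ennreal (real (card M) * (pi * (m / 2)\<^sup>2))"
    by (simp add: ennreal_mult ennreal_of_nat_eq_real_of_nat)
  finally have "ennreal (real (card M) * (pi * (m / 2)\<^sup>2)) = emeasure lborel ?K" ..
  also have "\<dots> \<le> ennreal (pi * ((p + m) / 2)\<^sup>2)"
  proof (rule isodiametric)
    fix z w assume "z \<in> ?K" "w \<in> ?K"
    then obtain u v where uv: "u \<in> M" "v \<in> M" "dist u z < m / 2" "dist v w < m / 2" by auto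
    have "dist z w \<le> dist u z + dist u v + dist v w"
      using dist_triangle[of z w u] dist_triangle[of u w v] by (simp add: dist_commute)
    then show "dist z w \<le> p + m" using hi[OF uv(1,2)] uv(3,4) by simp
  qed (use m p in \<open>auto intro!: borel_open open_UN\<close>)
  finally have "real (card M) * (pi * (m / 2)\<^sup>2) \<le> pi * ((p + m) / 2)\<^sup>2"
    by (subst (asm) ennreal_le_iff) auto
  then have "pi * (real (card M) * m\<^sup>2) \<le> pi * (p + m)\<^sup>2" by (simp add: power_divide algebra_simps)
  then show ?thesis by simp
qed

lemma packing:
  fixes M :: "complex set"
  assumes fin: "finite M" and m: "0 < m" and p: "0 \<le> p"
    and lo: "\<And>u v. u \<in> M \<Longrightarrow> v \<in> M \<Longrightarrow> u \<noteq> v \<Longrightarrow> m \<le> dist u v"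
    and hi: "\<And>u v. u \<in> M \<Longrightarrow> v \<in> M \<Longrightarrow> dist u v \<le> p"
  shows "real (card M) * m\<^sup>2 \<le> (p + m)\<^sup>2"
proof -
  let ?f = "\<lambda>z. (Re z, Im z)"
  have inj: "inj_on ?f M" by (auto simp: inj_on_def complex_eq_iff)
  have ds: "dist (?f u) (?f v) = dist u v" for u v
    by (simp add: dist_prod_def dist_norm cmod_def)
  have "real (card (?f ` M)) * m\<^sup>2 \<le> (p + m)\<^sup>2"
  proof (rule packing_prod[where p = p])
    fix x y assume "x \<in> ?f ` M" "y \<in> ?f ` M" "x \<noteq> y"
    then obtain u v where "u \<in> M" "v \<in> M" "u \<noteq> v" "x = ?f u" "y = ?f v" by auto
    then show "m \<le> dist x y" using lo by (simp only: ds)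
  next
    fix x y assume "x \<in> ?f ` M" "y \<in> ?f ` M"
    then obtain u v where "u \<in> M" "v \<in> M" "x = ?f u" "y = ?f v" by auto
    then show "dist x y \<le> p" using hi by (simp only: ds)
  qed (use fin m p in auto)
  then show ?thesis by (simp add: card_image[OF inj])
qed

subsection \<open>Numerical estimates\<close>

text \<open>\<open>gamma\<close> is the positive root of
  \<open>4 * beta\<^sup>2 * g\<^sup>2 + gamma2 * g = 1\<close>, whose left side increases for
  positive \<open>g\<close>. Each bound thus only asks on which side of 1 this quadratic lies at a
  rational point. The counting argument is carried out with the slightly larger constant
  \<open>100 / 219\<close>.\<close>

lemma gamma_upper: "gamma \<le> 100 / 219" and gamma_lower: "0.45557 < gamma"
proof -
  have s3: "1.7320508 < sqrt (3::real)" by (rule real_less_rsqrt) (simp add: power2_eq_square)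
  have s21: "146.594679 < sqrt (21490::real)" by (rule real_less_rsqrt) (simp add: power2_eq_square)
  have s21u: "sqrt (21490::real) < 146.6" by (rule real_less_lsqrt) (simp_all add: power2_eq_square)
  have s647: "25.436194 < sqrt (647::real)" by (rule real_less_rsqrt) (simp add: power2_eq_square)
  have s647': "25 < sqrt (647::real)" by (rule real_less_rsqrt) simp
  have "2 / sqrt (3::real) \<le> 2 / 1.7320508" using s3 by (intro divide_left_mono) auto
  then have "2 / sqrt 3 + 1 / 21490 \<le> (1.0745916::real)\<^sup>2" by (simp add: power2_eq_square)
  then have b1: "sqrt (2 / sqrt 3 + 1 / 21490) \<le> 1.0745916" by (intro real_le_lsqrt) auto
  have "1 / sqrt (21490::real) \<le> 1 / 146.594679" using s21 by (intro divide_left_mono) auto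
  then have "beta \<le> 1.0745916 + 1 / 146.594679" unfolding beta_def using b1 by linarith
  then have bu: "beta \<le> 1.0814132" by simp
  have b0: "1 \<le> beta"
  proof -
    have "sqrt (3::real) \<le> 2" by (rule real_le_lsqrt) auto
    then have "1 \<le> 2 / sqrt (3::real)" by (simp add: le_divide_eq)
    then have "1 \<le> sqrt (2 / sqrt 3 + 1 / 21490)" by (intro real_le_rsqrt) (simp add: add_increasing2)
    then show ?thesis unfolding beta_def by (smt (verit) divide_nonneg_nonneg real_sqrt_ge_zero)
  qed
  have g2u: "gamma2 \<le> 0.0639583"
  proof -
    have "gamma2 \<le> 3846 / (2593 * 25.436194 - 5823)"
      unfolding gamma2_def using s647 by (intro divide_left_mono) auto
    then show ?thesis by simp
  qed
  have g20: "0 \<le> gamma2" unfolding gamma2_def using s647' by (intro divide_nonneg_nonneg) linarith+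
  have "4 * 0.45557\<^sup>2 * beta\<^sup>2 + 0.45557 * gamma2 \<le> 4 * 0.45557\<^sup>2 * 1.0814132\<^sup>2 + 0.45557 * (0.0639583::real)"
    using bu g2u b0 by (intro add_mono mult_left_mono power_mono) auto
  also have "\<dots> < 1" by (simp add: power2_eq_square)
  finally have key: "4 * 0.45557\<^sup>2 * beta\<^sup>2 + 0.45557 * gamma2 < 1" .
  have pos: "0 < 8 * beta\<^sup>2" using b0 by simp
  have "8 * beta\<^sup>2 * 0.45557 + gamma2 < sqrt (16 * beta\<^sup>2 + gamma2\<^sup>2)"
  proof (rule real_less_rsqrt)
    have "(8 * beta\<^sup>2 * 0.45557 + gamma2)\<^sup>2
        = 16 * beta\<^sup>2 * (4 * 0.45557\<^sup>2 * beta\<^sup>2 + 0.45557 * gamma2) + gamma2\<^sup>2"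
      by (simp add: power2_eq_square algebra_simps)
    also have "\<dots> < 16 * beta\<^sup>2 * 1 + gamma2\<^sup>2" using key b0 by (intro add_strict_right_mono mult_strict_left_mono) auto
    finally show "(8 * beta\<^sup>2 * 0.45557 + gamma2)\<^sup>2 < 16 * beta\<^sup>2 + gamma2\<^sup>2" by simp
  qed
  then show "0.45557 < gamma" unfolding gamma_def using pos by (simp add: less_divide_eq algebra_simps)
  have s3u: "sqrt (3::real) < 1.7320509" by (rule real_less_lsqrt) (simp_all add: power2_eq_square)
  have "1 / 146.6 \<le> 1 / sqrt (21490::real)" using s21u by (intro divide_left_mono) auto
  moreover have "2 / 1.7320509 \<le> 2 / sqrt (3::real)" using s3u by (intro divide_left_mono) auto
  then have "1.0745 \<le> sqrt (2 / sqrt 3 + 1 / 21490)"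
    by (intro real_le_rsqrt) (simp add: power2_eq_square)
  ultimately have bl: "1.081 \<le> beta" unfolding beta_def by simp
  have g2l: "0.06 \<le> gamma2"
  proof -
    have "sqrt (647::real) \<le> 25.5" by (rule real_le_lsqrt) (simp_all add: power2_eq_square)
    then have "3846 / (2593 * 25.5 - 5823) \<le> gamma2"
      unfolding gamma2_def using s647 by (intro divide_left_mono mult_pos_pos) auto
    then show ?thesis by simp
  qed
  have "1 \<le> 4 * (100/219)\<^sup>2 * (1.081::real)\<^sup>2 + (100/219) * 0.06" by (simp add: power2_eq_square)
  also have "\<dots> \<le> 4 * (100/219)\<^sup>2 * beta\<^sup>2 + (100/219) * gamma2"
    using bl g2l by (intro add_mono mult_left_mono power_mono) auto
  finally have key: "1 \<le> 4 * (100/219)\<^sup>2 * beta\<^sup>2 + (100/219) * gamma2" .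
  have "sqrt (16 * beta\<^sup>2 + gamma2\<^sup>2) \<le> 8 * beta\<^sup>2 * (100/219) + gamma2"
  proof (rule real_le_lsqrt)
    have "16 * beta\<^sup>2 * 1 + gamma2\<^sup>2
       \<le> 16 * beta\<^sup>2 * (4 * (100/219)\<^sup>2 * beta\<^sup>2 + (100/219) * gamma2) + gamma2\<^sup>2"
      using key b0 by (intro add_right_mono mult_left_mono) auto
    also have "\<dots> = (8 * beta\<^sup>2 * (100/219) + gamma2)\<^sup>2"
      by (simp add: power2_eq_square algebra_simps)
    finally show "16 * beta\<^sup>2 + gamma2\<^sup>2 \<le> (8 * beta\<^sup>2 * (100/219) + gamma2)\<^sup>2" by simp
  qed (use g20 in auto)
  then show "gamma \<le> 100 / 219" unfolding gamma_def using pos by (simp add: divide_le_eq algebra_simps)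
qed

text \<open>Fourth powers clear the fractional exponents, and \<open>100 / 219\<close> fits in
  between.\<close>

lemma gamma_less_asymptotic: "gamma < 3 powr (1/4) * 2 powr (-3/2)"
proof -
  let ?g = "(3::real) powr (1/4) * 2 powr (-3/2)"
  have "?g ^ 4 = 3 / 64"
    by (simp add: power_mult_distrib powr_power powr_minus divide_simps)
  then have "(100 / 219) ^ 4 < ?g ^ 4" by (simp add: power_divide)
  then have "100 / 219 < ?g" by (rule power_less_imp_less_base) simp
  then show ?thesis using gamma_upper by linarith
qed

text \<open>If the conclusion fails, \<open>pack2\<close> bounds \<open>p\<close> from below and
  \<open>count\<close> bounds it from above. Eliminating \<open>p\<close> leaves only
  \<open>m1 < 5\<close> and then finitely many cases. The second halves of \<open>L1\<close> and
  \<open>L2\<close> settle those in which packing and counting alone leave room.\<close>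

lemma integral_point_count_arith:
  fixes p m1 m2 n L1 L2 :: nat
  assumes m: "1 \<le> m1" "m1 \<le> m2" and p1: "1 \<le> p"
    and pack1: "real n * (real m1)\<^sup>2 \<le> (real p + real m1)\<^sup>2"
    and pack2: "(real n - 1) * (real m2)\<^sup>2 \<le> (real p + real m2)\<^sup>2"
    and count: "n \<le> 4 * m2 * (m1 - 1) + L1 + L2"
    and L1: "real m1 * (real L1 - 1) \<le> real p" "L1 = 2 * m1 \<Longrightarrow> 2 \<le> m1 \<Longrightarrow> p > m1 * (2 * m1 - 1)"
    and L2: "real m1 * (real L2 - 1) \<le> real p" "L2 = 2 * m1 \<Longrightarrow> 2 \<le> m1 \<Longrightarrow> p > m1 * (2 * m1 - 1)"
  shows "100 * (real n - 2) \<le> 219 * real p"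
proof (rule ccontr)
  assume "\<not> ?thesis"
  then have n: "100 * (real n - 2) > 219 * real p" by simp
  define a b P where "a = real m1" and "b = real m2" and "P = real p"
  have ab: "1 \<le> a" "a \<le> b" "1 \<le> P" using m p1 by (auto simp: a_def b_def P_def)
  have L: "a * (real L1 - 1) \<le> P" "a * (real L2 - 1) \<le> P" using L1(1) L2(1) by (auto simp: a_def P_def)
  have c: "real n \<le> 4 * b * (a - 1) + real L1 + real L2"
  proof -
    have "real n \<le> real (4 * m2 * (m1 - 1) + L1 + L2)" using count by (simp only: of_nat_le_iff)
    then show ?thesis using m(1) by (simp add: a_def b_def of_nat_diff)
  qed
  have bP: "219 / 100 * P < real n - 2" using n by (simp add: P_def)
  have e1: "219 * b < 100 * P / b + 200"
  proof -
    have "(1 + 219 / 100 * P) * b\<^sup>2 < (P + b)\<^sup>2"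
    proof (rule less_le_trans)
      show "(1 + 219 / 100 * P) * b\<^sup>2 < (real n - 1) * b\<^sup>2"
        using bP ab by (intro mult_strict_right_mono) auto
    qed (use pack2 in \<open>simp add: b_def P_def\<close>)
    then have "P * (219 * b\<^sup>2) < P * (100 * P + 200 * b)" by (simp add: power2_eq_square algebra_simps)
    then have "219 * b\<^sup>2 < 100 * P + 200 * b" using ab by simp
    then show ?thesis using ab by (simp add: field_simps power2_eq_square)
  qed
  show False
  proof (cases "m1 = 1")
    case True
    \<comment> \<open>There are no hyperbolas, and the two lines carry at most
      \<open>2 * P + 2\<close> points.\<close>
    then show False using c L bP ab by (simp add: a_def)
  next
    case False
    then have a2: "2 \<le> a" "2 \<le> m1" using m by (auto simp: a_def)
    have "a * real n \<le> a * (4 * b * (a - 1) + real L1 + real L2)" using c ab by simp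
    then have "a * (219 / 100 * P + 2) < 4 * a * b * (a - 1) + 2 * P + 2 * a"
      using L bP ab mult_strict_left_mono[of "219/100*P + 2" "real n" a] by (simp add: algebra_simps)
    then have e2: "(219 * a - 200) * P < 400 * a * b * (a - 1)" by (simp add: algebra_simps)
    have e1': "b * (219 * b - 200) < 100 * P" using e1 ab by (simp add: field_simps)
    have "(219 * a - 200) * (b * (219 * b - 200)) < (219 * a - 200) * (100 * P)"
      using e1' a2 by (intro mult_strict_left_mono) auto
    also have "\<dots> < 100 * (400 * a * b * (a - 1))" using e2 by (simp add: algebra_simps)
    finally have "b * ((219 * a - 200) * (219 * b - 200)) < b * (40000 * a * (a - 1))" by (simp add: algebra_simps)
    then have e3: "(219 * a - 200) * (219 * b - 200) < 40000 * a * (a - 1)" using ab by simp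
    have "(219 * a - 200) * (219 * a - 200) \<le> (219 * a - 200) * (219 * b - 200)"
      using ab a2 by (intro mult_left_mono) auto
    with e3 have "(219 * a - 200) * (219 * a - 200) < 40000 * a * (a - 1)" by simp
    \<comment> \<open>The leading coefficient \<open>219\<^sup>2 - 200\<^sup>2\<close> is positive
      because 2.19 exceeds 2, so \<open>a\<close> is bounded.\<close>
    then have "7961 * (a * a) - 47600 * a + 40000 < 0" by (simp add: algebra_simps)
    then have "a * (7961 * a - 47600) < - 40000" by (simp add: algebra_simps)
    moreover have "5 * (7961 * 5 - 47600) \<le> a * (7961 * a - 47600)" if "5 \<le> a"
    proof -
      have "0 \<le> (a - 5) * (7961 * (a + 5) - 47600)" using that by (intro mult_nonneg_nonneg) auto
      then show ?thesis by (simp add: algebra_simps)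
    qed
    ultimately have "a < 5" by (cases "5 \<le> a") simp_all
    then have "m1 = 2 \<or> m1 = 3 \<or> m1 = 4" using a2 by (auto simp: a_def)
    \<comment> \<open>For these \<open>m1\<close>, \<open>e3\<close> rules out every
      \<open>m2 > m1\<close>.\<close>
    then consider "m1 = 2" "m2 = 2" | "m1 = 3" "m2 = 3" | "m1 = 4" "m2 = 4"
      using e3 m(2) by (auto simp: a_def b_def)
    then show False
    proof cases
      case 1
      \<comment> \<open>\<open>p = 5\<close> contradicts \<open>pack1\<close>. For
        \<open>p = 6\<close> the negated conclusion needs \<open>n >= 16\<close>, but with at most
        three points on each line \<open>count\<close> gives \<open>n <= 14\<close>. The other cases
        are similar.\<close>
      have "p = 5 \<or> p = 6" using e1' e2 1 by (auto simp: a_def b_def P_def)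
      moreover from this have "L1 \<noteq> 2 * m1" "L2 \<noteq> 2 * m1" using L1(2) L2(2) 1 by auto
      ultimately show False using n pack1 count L1(1) L2(1) 1 by (auto simp: power2_eq_square)
    next
      case 2
      have "p = 14 \<or> p = 15" using e1' e2 2 by (auto simp: a_def b_def P_def)
      moreover from this have "L1 \<noteq> 2 * m1" "L2 \<noteq> 2 * m1" using L1(2) L2(2) 2 by auto
      ultimately show False using n pack1 count L1(1) L2(1) 2 by (auto simp: power2_eq_square)
    next
      case 3
      have "p = 28" using e1' e2 3 by (auto simp: a_def b_def P_def)
      moreover from this have "L1 \<noteq> 2 * m1" "L2 \<noteq> 2 * m1" using L1(2) L2(2) 3 by auto
      ultimately show False using n pack1 count L1(1) L2(1) 3 by (auto simp: power2_eq_square)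
    qed
  qed
qed

subsection \<open>Integral distances along a line\<close>

lemma enumerate_gaps:
  fixes T :: "real set"
  assumes fin: "finite T" and m: "0 < m"
    and gap: "\<And>s t. s \<in> T \<Longrightarrow> t \<in> T \<Longrightarrow> s \<noteq> t \<Longrightarrow> m \<le> \<bar>s - t\<bar>"
  obtains t :: "nat \<Rightarrow> real" where "T = t ` {..<card T}"
    and "\<And>i j. i \<le> j \<Longrightarrow> j < card T \<Longrightarrow> m * real (j - i) \<le> t j - t i"
proof
  let ?l = "sorted_list_of_set T"
  have len: "length ?l = card T" by simp
  show "T = (!) ?l ` {..<card T}"
    using nth_image[of "card T" ?l] fin by (simp add: lessThan_atLeast0)
  show "m * real (j - i) \<le> ?l ! j - ?l ! i" if "i \<le> j" "j < card T" for i j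
    using that
  proof (induction j rule: dec_induct)
    case (step k)
    have "?l ! k < ?l ! Suc k"
      using sorted_wrt_nth_less[OF strict_sorted_list_of_set, of k "Suc k" T] step.prems len by simp
    moreover have "?l ! k \<in> T" "?l ! Suc k \<in> T"
      using step.prems fin len by (metis Suc_lessD nth_mem set_sorted_list_of_set)+
    ultimately have "m \<le> ?l ! Suc k - ?l ! k" using gap[of "?l ! Suc k" "?l ! k"] by auto
    then show ?case using step by (simp add: Suc_diff_le algebra_simps)
  qed simp
qed

lemma card_gaps_le:
  fixes T :: "real set"
  assumes fin: "finite T" and m: "0 < m" and p: "0 \<le> p"
    and gap: "\<And>s t. s \<in> T \<Longrightarrow> t \<in> T \<Longrightarrow> s \<noteq> t \<Longrightarrow> m \<le> \<bar>s - t\<bar>"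
    and hi: "\<And>s t. s \<in> T \<Longrightarrow> t \<in> T \<Longrightarrow> \<bar>s - t\<bar> \<le> p"
  shows "m * (real (card T) - 1) \<le> p"
proof (cases "card T = 0")
  case True
  then show ?thesis using m p by (simp add: algebra_simps)
next
  case False
  obtain t where t: "T = t ` {..<card T}"
    "\<And>i j. i \<le> j \<Longrightarrow> j < card T \<Longrightarrow> m * real (j - i) \<le> t j - t i"
    using enumerate_gaps[OF fin m gap] by metis
  have "t 0 \<in> T" "t (card T - 1) \<in> T" using False by (subst t(1); force)+
  then show ?thesis using t(2)[of 0 "card T - 1"] hi[of "t (card T - 1)" "t 0"] False
    by (simp add: of_nat_diff)
qed

text \<open>The distances to consecutive points form a strictly convex integer sequence whose
  \<open>2m - 1\<close> increments lie strictly between \<open>-m\<close> and \<open>m\<close>; hence they are exactly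
  \<open>-(m-1), \<dots>, m-1\<close>, and the two middle increments \<open>0, 1\<close> contradict parity.\<close>
lemma no_integral_distances_progression:
  fixes c :: "nat \<Rightarrow> int" and h s :: real
  assumes m: "2 \<le> m" and h: "h \<noteq> 0"
    and c: "\<And>i. i < 2 * m \<Longrightarrow> 0 \<le> c i \<and> (real_of_int (c i))\<^sup>2 = h\<^sup>2 + (s + real m * real i)\<^sup>2"
  shows False
proof -
  define d where "d i = c (Suc i) - c i" for i
  have d_bound: "\<bar>d i\<bar> < int m" if i: "Suc i < 2 * m" for i
  proof -
    let ?x = "s + real m * real i" and ?u = "real_of_int (c i)" and ?v = "real_of_int (c (Suc i))"
    have u: "?u\<^sup>2 = h\<^sup>2 + ?x\<^sup>2" and v: "?v\<^sup>2 = h\<^sup>2 + (?x + real m)\<^sup>2" and uv: "0 \<le> ?u" "0 \<le> ?v"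
      using c[of i] c[of "Suc i"] i by (simp_all add: algebra_simps)
    \<comment> \<open>Lagrange's identity for the vectors \<open>(h, x)\<close> and
      \<open>(h, x + m)\<close>; its right side is positive, which makes Cauchy-Schwarz and the
      triangle inequality strict.\<close>
    have "(?u * ?v)\<^sup>2 - (h\<^sup>2 + ?x * (?x + real m))\<^sup>2 = h\<^sup>2 * (real m)\<^sup>2"
      unfolding power_mult_distrib u v by (simp add: power2_eq_square algebra_simps)
    moreover have "0 < h\<^sup>2 * (real m)\<^sup>2" using h m by simp
    ultimately have "(h\<^sup>2 + ?x * (?x + real m))\<^sup>2 < (?u * ?v)\<^sup>2" by linarith
    then have "h\<^sup>2 + ?x * (?x + real m) < ?u * ?v" by (rule power2_less_imp_less) (use uv in simp)
    moreover have "(?v - ?u)\<^sup>2 = (real m)\<^sup>2 - 2 * (?u * ?v - (h\<^sup>2 + ?x * (?x + real m)))"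
      unfolding power2_diff u v by (simp add: power2_eq_square algebra_simps)
    ultimately have "(?v - ?u)\<^sup>2 < (real m)\<^sup>2" by simp
    then have "\<bar>?v - ?u\<bar> < real m" by (intro power2_less_imp_less[of "\<bar>?v - ?u\<bar>"]) simp_all
    then show ?thesis unfolding d_def by linarith
  qed
  have d_mono: "d i < d (Suc i)" if i: "Suc (Suc i) < 2 * m" for i
  proof (rule ccontr)
    assume "\<not> d i < d (Suc i)"
    then have le: "c i + c (Suc (Suc i)) \<le> 2 * c (Suc i)" by (simp add: d_def)
    let ?x = "s + real m * real (Suc i)"
    let ?u = "real_of_int (c i)" and ?w = "real_of_int (c (Suc i))" and ?v = "real_of_int (c (Suc (Suc i)))"
    have u: "?u\<^sup>2 = h\<^sup>2 + (?x - real m)\<^sup>2" and w: "?w\<^sup>2 = h\<^sup>2 + ?x\<^sup>2" and v: "?v\<^sup>2 = h\<^sup>2 + (?x + real m)\<^sup>2"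
      and pos: "0 \<le> ?u" "0 \<le> ?v"
      using c[of i] c[of "Suc i"] c[of "Suc (Suc i)"] i by (simp_all add: algebra_simps)
    \<comment> \<open>If convexity failed, the parallelogram law would force
      \<open>|v - u| >= 2 * m\<close>, against two increments of modulus below
      \<open>m\<close>.\<close>
    have "?u + ?v \<le> 2 * ?w" using le by linarith
    then have "(?u + ?v)\<^sup>2 \<le> (2 * ?w)\<^sup>2" using pos by (intro power_mono) auto
    moreover have "(?u + ?v)\<^sup>2 + (?v - ?u)\<^sup>2 = 2 * ?u\<^sup>2 + 2 * ?v\<^sup>2"
      by (simp add: power2_eq_square algebra_simps)
    moreover have "2 * ?u\<^sup>2 + 2 * ?v\<^sup>2 = (2 * ?w)\<^sup>2 + 4 * (real m)\<^sup>2"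
      unfolding u v power_mult_distrib w by (simp add: power2_eq_square algebra_simps)
    ultimately have "(2 * real m)\<^sup>2 \<le> (?v - ?u)\<^sup>2" by (simp add: power_mult_distrib)
    then have "\<bar>2 * real m\<bar> \<le> \<bar>?v - ?u\<bar>" by (simp only: abs_le_square_iff)
    moreover have "\<bar>?v - ?u\<bar> < 2 * real m"
      using d_bound[of i] d_bound[of "Suc i"] i unfolding d_def by linarith
    ultimately show False by simp
  qed
  have d_gap: "int (j - i) \<le> d j - d i" if "i \<le> j" "Suc j < 2 * m" for i j
    using that
  proof (induction j rule: dec_induct)
    case (step k)
    then show ?case using d_mono[of k] by (simp add: Suc_diff_le)
  qed simp
  have d_eq: "d i = int i - (int m - 1)" if "Suc i < 2 * m" for i
  proof -
    have "int i \<le> d i - d 0" "int (2 * m - 2 - i) \<le> d (2 * m - 2) - d i"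
      using d_gap[of 0 i] d_gap[of i "2 * m - 2"] that m by auto
    moreover have "Suc (2 * m - 2) < 2 * m" using m by simp
    then have "- int m < d 0" "d (2 * m - 2) < int m"
      using d_bound[of 0] d_bound[of "2 * m - 2"] m by (auto simp: abs_less_iff)
    ultimately show ?thesis using that m by (simp add: of_nat_diff)
  qed
  have c1: "c (m - 1) = c m" and c2: "c (Suc m) = c m + 1"
    using d_eq[of "m - 1"] d_eq[of m] m by (simp_all add: d_def of_nat_diff)
  \<comment> \<open>Second difference of the quadratic in \<open>i\<close>; the increments 0 and 1
    turn the left side into the odd number \<open>2 * c m + 1\<close>. The index
    \<open>Suc m\<close> is in range since \<open>2 \<le> m\<close>.\<close>
  have "(real_of_int (c (Suc m)))\<^sup>2 - 2 * (real_of_int (c m))\<^sup>2 + (real_of_int (c (m - 1)))\<^sup>2 = 2 * (real m)\<^sup>2"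
    using c[of "Suc m"] c[of m] c[of "m - 1"] m
    by (simp add: of_nat_diff power2_eq_square algebra_simps)
  then have "real_of_int (2 * c m + 1) = real_of_int (2 * (int m)\<^sup>2)"
    unfolding c1 c2 by (simp add: power2_eq_square algebra_simps)
  then have "2 * c m + 1 = 2 * (int m)\<^sup>2" by (simp only: of_int_eq_iff)
  then show False by presburger
qed

text \<open>The line is the preimage of the real axis under \<open>(z - c) / w\<close>. If
  \<open>p <= m * (2 * m - 1)\<close>, then \<open>2 * m\<close> points with gaps at least
  \<open>m\<close> have no slack, so they form the progression excluded by
  \<open>no_integral_distances_progression\<close>.\<close>

lemma collinear_integral_bounds:
  fixes L :: "complex set" and m :: nat and p :: nat
  assumes fin: "finite L" and w: "w \<noteq> 0" and m: "0 < m"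
    and line: "\<And>z. z \<in> L \<Longrightarrow> Im ((z - c) / w) = 0"
    and lo: "\<And>y z. y \<in> L \<Longrightarrow> z \<in> L \<Longrightarrow> y \<noteq> z \<Longrightarrow> real m \<le> dist y z"
    and hi: "\<And>y z. y \<in> L \<Longrightarrow> z \<in> L \<Longrightarrow> dist y z \<le> real p"
  shows "real m * (real (card L) - 1) \<le> real p"
    and "\<lbrakk>Im ((P - c) / w) \<noteq> 0; \<And>z. z \<in> L \<Longrightarrow> dist P z \<in> \<int>; card L = 2 * m; 2 \<le> m\<rbrakk>
      \<Longrightarrow> m * (2 * m - 1) < p"
proof -
  \<comment> \<open>The factor \<open>cmod w\<close> restores Euclidean length along the
    line.\<close>
  define t where "t z = cmod w * Re ((z - c) / w)" for z
  have dist_sq: "(dist y z)\<^sup>2 = (cmod w * Im ((y - c) / w))\<^sup>2 + (t y - t z)\<^sup>2" if z: "z \<in> L" for y z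
  proof -
    have "y - z = w * ((y - c) / w - (z - c) / w)" using w by (simp add: diff_divide_distrib[symmetric])
    then have "(dist y z)\<^sup>2 = (cmod w)\<^sup>2 * (cmod ((y - c) / w - (z - c) / w))\<^sup>2"
      by (simp add: dist_norm norm_mult power_mult_distrib)
    also have "(cmod ((y - c) / w - (z - c) / w))\<^sup>2 = (Re ((y - c) / w) - Re ((z - c) / w))\<^sup>2 + (Im ((y - c) / w))\<^sup>2"
      using line[OF z] by (simp add: cmod_power2)
    finally show ?thesis
      unfolding t_def right_diff_distrib[symmetric] power_mult_distrib by (simp add: algebra_simps)
  qed
  have dist_t: "\<bar>t y - t z\<bar> = dist y z" if "y \<in> L" "z \<in> L" for y z
  proof -
    have "(dist y z)\<^sup>2 = (t y - t z)\<^sup>2" using dist_sq[OF that(2), of y] line[OF that(1)] by simp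
    then show ?thesis by (metis abs_of_nonneg power2_eq_iff_nonneg power2_abs zero_le_dist abs_ge_zero)
  qed
  have inj: "inj_on t L" using dist_t by (metis abs_0 dist_eq_0_iff diff_self inj_onI)
  have card: "card (t ` L) = card L" by (rule card_image[OF inj])
  have gap: "real m \<le> \<bar>s - r\<bar>" if "s \<in> t ` L" "r \<in> t ` L" "s \<noteq> r" for s r :: real
  proof -
    obtain y z where "y \<in> L" "z \<in> L" "s = t y" "r = t z" using \<open>s \<in> t ` L\<close> \<open>r \<in> t ` L\<close> by auto
    then show ?thesis using lo[of y z] \<open>s \<noteq> r\<close> by (auto simp: dist_t)
  qed
  have diam: "\<bar>s - r\<bar> \<le> real p" if "s \<in> t ` L" "r \<in> t ` L" for s r
    using that hi by (auto simp: dist_t)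
  show "real m * (real (card L) - 1) \<le> real p"
    using card_gaps_le[of "t ` L" "real m" "real p"] fin m gap diam by (simp add: card)
  assume P: "Im ((P - c) / w) \<noteq> 0" and int: "\<And>z. z \<in> L \<Longrightarrow> dist P z \<in> \<int>"
    and cL: "card L = 2 * m" and m2: "2 \<le> m"
  show "m * (2 * m - 1) < p"
  proof (rule ccontr)
    assume "\<not> m * (2 * m - 1) < p"
    then have "real p \<le> real (m * (2 * m - 1))" by (simp only: of_nat_le_iff not_less)
    then have pm: "real p \<le> real m * real (2 * m - 1)" by (simp only: of_nat_mult)
    obtain e where e: "t ` L = e ` {..<2 * m}"
      "\<And>i j. i \<le> j \<Longrightarrow> j < 2 * m \<Longrightarrow> real m * real (j - i) \<le> e j - e i"
      using enumerate_gaps[of "t ` L" "real m"] fin m gap unfolding card cL by (metis finite_imageI of_nat_0_less_iff)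
    have eL: "e i \<in> t ` L" if "i < 2 * m" for i using that e(1) by blast
    \<comment> \<open>The lower bounds for the stretches before and after index \<open>i\<close>
      already add up to the largest possible extent, so both are equalities.\<close>
    have ei: "e i = e 0 + real m * real i" if i: "i < 2 * m" for i
    proof -
      have "e (2 * m - 1) - e 0 \<le> real p"
        using diam[OF eL eL, of "2 * m - 1" 0] m by auto
      moreover have "real m * real i \<le> e i - e 0" using e(2)[of 0 i] i by simp
      moreover have "real m * real (2 * m - 1 - i) \<le> e (2 * m - 1) - e i" using e(2)[of i "2 * m - 1"] i by simp
      moreover have "real m * real (2 * m - 1 - i) = real m * real (2 * m - 1) - real m * real i"
        using i by (simp add: of_nat_diff algebra_simps)
      ultimately show ?thesis using pm by linarith
    qed
    have "\<exists>k::int. 0 \<le> k \<and> (real_of_int k)\<^sup>2 = (cmod w * Im ((P - c) / w))\<^sup>2 + (e 0 - t P + real m * real i)\<^sup>2"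
      if i: "i < 2 * m" for i
    proof -
      obtain z where z: "z \<in> L" "e i = t z" using eL[OF i] by blast
      obtain k where k: "dist P z = of_int k" using int[OF z(1)] by (auto elim: Ints_cases)
      have "0 \<le> k" using k by (metis of_int_0_le_iff zero_le_dist)
      moreover have "(t P - t z)\<^sup>2 = (e 0 - t P + real m * real i)\<^sup>2"
        unfolding z(2)[symmetric] ei[OF i] by (simp add: power2_eq_square algebra_simps)
      ultimately show ?thesis using dist_sq[OF z(1), of P] k by auto
    qed
    then obtain k :: "nat \<Rightarrow> int" where k: "\<And>i. i < 2 * m \<Longrightarrow> 0 \<le> k i \<and>
        (real_of_int (k i))\<^sup>2 = (cmod w * Im ((P - c) / w))\<^sup>2 + (e 0 - t P + real m * real i)\<^sup>2" by metis
    have "cmod w * Im ((P - c) / w) \<noteq> 0" using P w by simp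
    from no_integral_distances_progression[OF m2 this k] show False .
  qed
qed

subsection \<open>Intersections of hyperbolas\<close>

text \<open>Squaring removes both roots. The equation also covers the degenerate loci:
  \<open>a = 0\<close> gives the perpendicular bisector of the foci, \<open>a = cmod v\<close> the
  line through them.\<close>

lemma conic_of_distance_difference:
  fixes z c v :: complex
  assumes "(cmod (z - (c - v)) - cmod (z - (c + v)))\<^sup>2 = 4 * a\<^sup>2"
  shows "((z - c) \<bullet> v)\<^sup>2 = a\<^sup>2 * ((cmod (z - c))\<^sup>2 + (cmod v)\<^sup>2 - a\<^sup>2)"
proof -
  let ?r = "cmod (z - (c - v))" and ?s = "cmod (z - (c + v))"
  have r: "?r\<^sup>2 = (cmod (z - c))\<^sup>2 + (cmod v)\<^sup>2 + 2 * ((z - c) \<bullet> v)"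
    and s: "?s\<^sup>2 = (cmod (z - c))\<^sup>2 + (cmod v)\<^sup>2 - 2 * ((z - c) \<bullet> v)"
    by (simp_all add: cmod_power2 inner_complex_def) (simp_all add: power2_eq_square algebra_simps)
  have "16 * ((z - c) \<bullet> v)\<^sup>2 = (?r\<^sup>2 - ?s\<^sup>2)\<^sup>2" unfolding r s by (simp add: power2_eq_square)
  also have "\<dots> = (?r - ?s)\<^sup>2 * (2 * (?r\<^sup>2 + ?s\<^sup>2) - (?r - ?s)\<^sup>2)"
    by (simp add: power2_eq_square algebra_simps)
  also have "\<dots> = 4 * a\<^sup>2 * (2 * (?r\<^sup>2 + ?s\<^sup>2) - 4 * a\<^sup>2)" unfolding assms ..
  also have "\<dots> = 16 * (a\<^sup>2 * ((cmod (z - c))\<^sup>2 + (cmod v)\<^sup>2 - a\<^sup>2))" unfolding r s by (simp add: algebra_simps)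
  finally show ?thesis by simp
qed

text \<open>The points of the hyperbola are \<open>(a (s + 1/s) / 2, b (s - 1/s) / 2)\<close>; the polynomial below
  is \<open>4 s\<^sup>2\<close> times the conic evaluated there.\<close>
lemma hyperbola_conic_poly:
  fixes a b :: real
  assumes a: "0 < a" and b: "0 < b"
    and xy: "x\<^sup>2 / a\<^sup>2 - y\<^sup>2 / b\<^sup>2 = 1"
    and Q: "\<alpha> * x\<^sup>2 + \<beta> * x * y + \<gamma> * y\<^sup>2 + \<delta> * x + \<epsilon> * y + \<zeta> = 0"
  shows "poly [:\<alpha> * a\<^sup>2 - \<beta> * a * b + \<gamma> * b\<^sup>2, 2 * (\<delta> * a - \<epsilon> * b), 2 * (\<alpha> * a\<^sup>2 - \<gamma> * b\<^sup>2) + 4 * \<zeta>,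
     2 * (\<delta> * a + \<epsilon> * b), \<alpha> * a\<^sup>2 + \<beta> * a * b + \<gamma> * b\<^sup>2:] (x / a + y / b) = 0"
proof -
  define s t where "s = x / a + y / b" and "t = x / a - y / b"
  have st: "s * t = 1" using xy by (simp add: s_def t_def algebra_simps power2_eq_square)
  have x: "2 * x = a * (s + t)" and y: "2 * y = b * (s - t)" using a b by (simp_all add: s_def t_def field_simps)
  have "\<alpha> * (2*x)\<^sup>2 + \<beta> * (2*x) * (2*y) + \<gamma> * (2*y)\<^sup>2 + 2 * \<delta> * (2*x) + 2 * \<epsilon> * (2*y) + 4 * \<zeta> = 0"
    using Q by (simp add: power_mult_distrib algebra_simps)
  then have "s\<^sup>2 * (\<alpha> * (a * (s + t))\<^sup>2 + \<beta> * (a * (s + t)) * (b * (s - t)) + \<gamma> * (b * (s - t))\<^sup>2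
     + 2 * \<delta> * (a * (s + t)) + 2 * \<epsilon> * (b * (s - t)) + 4 * \<zeta>) = 0" unfolding x y by simp
  moreover have "s\<^sup>2 * (\<alpha> * (a * (s + t))\<^sup>2 + \<beta> * (a * (s + t)) * (b * (s - t)) + \<gamma> * (b * (s - t))\<^sup>2
     + 2 * \<delta> * (a * (s + t)) + 2 * \<epsilon> * (b * (s - t)) + 4 * \<zeta>)
    = \<alpha> * a\<^sup>2 * (s\<^sup>2 + s * t)\<^sup>2 + \<beta> * a * b * (s\<^sup>2 * s\<^sup>2 - (s * t)\<^sup>2) + \<gamma> * b\<^sup>2 * (s\<^sup>2 - s * t)\<^sup>2
     + 2 * \<delta> * a * s * (s\<^sup>2 + s * t) + 2 * \<epsilon> * b * s * (s\<^sup>2 - s * t) + 4 * \<zeta> * s\<^sup>2"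
    by (simp add: power2_eq_square algebra_simps)
  ultimately show ?thesis unfolding s_def[symmetric] st
    by (simp add: power2_eq_square algebra_simps)
qed

text \<open>The parameter \<open>s = x / a + y / b\<close> determines the point, because
  \<open>x / a - y / b = 1 / s\<close>; so points are counted by roots.\<close>

lemma card_hyperbola_le_degree:
  fixes a b :: real and S :: "complex set"
  assumes a: "0 < a" and b: "0 < b" and q: "q \<noteq> 0"
    and S: "\<And>z. z \<in> S \<Longrightarrow> (Re z)\<^sup>2 / a\<^sup>2 - (Im z)\<^sup>2 / b\<^sup>2 = 1"
    and root: "\<And>z. z \<in> S \<Longrightarrow> poly q (Re z / a + Im z / b) = 0"
  shows "card S \<le> degree q"
proof -
  let ?f = "\<lambda>z. Re z / a + Im z / b"
  have inj: "inj_on ?f S"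
  proof (rule inj_onI)
    fix z w assume z: "z \<in> S" and w: "w \<in> S" and e: "?f z = ?f w"
    have "?f u * (Re u / a - Im u / b) = 1" if "u \<in> S" for u
      using S[OF that] by (simp add: algebra_simps power2_eq_square)
    from this[OF z] this[OF w] have "Re z / a - Im z / b = Re w / a - Im w / b"
      unfolding e by (metis mult_cancel_left mult_zero_left zero_neq_one)
    with e have "Re z / a = Re w / a" "Im z / b = Im w / b" by linarith+
    then show "z = w" using a b by (simp add: complex_eq_iff)
  qed
  have "card S = card (?f ` S)" by (simp add: card_image[OF inj])
  also have "\<dots> \<le> card {s. poly q s = 0}"
    by (rule card_mono[OF poly_roots_finite[OF q]]) (use root in auto)
  also have "\<dots> \<le> degree q" by (rule card_poly_roots_bound[OF q])
  finally show ?thesis .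
qed

text \<open>The quartic vanishes identically exactly when the conic is a multiple of the equation of
  the hyperbola itself, which \<open>nz\<close> excludes.\<close>

lemma card_hyperbola_conic:
  fixes a b :: real and S :: "complex set"
  assumes a: "0 < a" and b: "0 < b"
    and S: "\<And>z. z \<in> S \<Longrightarrow> (Re z)\<^sup>2 / a\<^sup>2 - (Im z)\<^sup>2 / b\<^sup>2 = 1"
    and Q: "\<And>z. z \<in> S \<Longrightarrow> \<alpha> * (Re z)\<^sup>2 + \<beta> * Re z * Im z + \<gamma> * (Im z)\<^sup>2 + \<delta> * Re z + \<epsilon> * Im z + \<zeta> = 0"
    and nz: "\<not> (\<beta> = 0 \<and> \<delta> = 0 \<and> \<epsilon> = 0 \<and> \<alpha> * a\<^sup>2 = - \<zeta> \<and> \<gamma> * b\<^sup>2 = \<zeta>)"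
  shows "card S \<le> 4"
proof -
  let ?q = "[:\<alpha> * a\<^sup>2 - \<beta> * a * b + \<gamma> * b\<^sup>2, 2 * (\<delta> * a - \<epsilon> * b), 2 * (\<alpha> * a\<^sup>2 - \<gamma> * b\<^sup>2) + 4 * \<zeta>,
     2 * (\<delta> * a + \<epsilon> * b), \<alpha> * a\<^sup>2 + \<beta> * a * b + \<gamma> * b\<^sup>2:]"
  have q: "?q \<noteq> 0"
  proof
    assume q0: "?q = 0"
    then have eqs: "\<alpha> * a\<^sup>2 - \<beta> * a * b + \<gamma> * b\<^sup>2 = 0" "\<alpha> * a\<^sup>2 + \<beta> * a * b + \<gamma> * b\<^sup>2 = 0"
      "\<delta> * a - \<epsilon> * b = 0" "\<delta> * a + \<epsilon> * b = 0" "2 * (\<alpha> * a\<^sup>2 - \<gamma> * b\<^sup>2) + 4 * \<zeta> = 0"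
      unfolding pCons_eq_0_iff mult_eq_0_iff[of 2] by auto
    have sums: "\<beta> * a * b = 0" "\<delta> * a = 0" "\<epsilon> * b = 0" "\<alpha> * a\<^sup>2 + \<gamma> * b\<^sup>2 = 0"
      using eqs(1-4) by linarith+
    moreover have "\<alpha> * a\<^sup>2 - \<gamma> * b\<^sup>2 = - 2 * \<zeta>" using eqs(5) by (simp add: algebra_simps)
    with sums(4) have "\<alpha> * a\<^sup>2 = - \<zeta>" "\<gamma> * b\<^sup>2 = \<zeta>" by linarith+
    ultimately show False using nz a b by simp
  qed
  have "card S \<le> degree ?q"
    by (rule card_hyperbola_le_degree[OF a b q S]) (use hyperbola_conic_poly[OF a b S Q] in auto)
  also have "\<dots> \<le> 4" by simp
  finally show ?thesis .
qed

text \<open>Without a quadratic part the quartic is \<open>2 * s\<close> times a quadratic, and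
  \<open>s\<close> is nonzero on the hyperbola.\<close>

lemma card_hyperbola_line:
  fixes a b :: real and S :: "complex set"
  assumes a: "0 < a" and b: "0 < b"
    and S: "\<And>z. z \<in> S \<Longrightarrow> (Re z)\<^sup>2 / a\<^sup>2 - (Im z)\<^sup>2 / b\<^sup>2 = 1"
    and Q: "\<And>z. z \<in> S \<Longrightarrow> \<delta> * Re z + \<epsilon> * Im z + \<zeta> = 0"
    and nz: "\<delta> \<noteq> 0 \<or> \<epsilon> \<noteq> 0"
  shows "card S \<le> 2"
proof -
  let ?q = "[:\<delta> * a - \<epsilon> * b, 2 * \<zeta>, \<delta> * a + \<epsilon> * b:]"
  have q: "?q \<noteq> 0"
  proof
    assume q0: "?q = 0"
    then have "\<delta> * a = 0" "\<epsilon> * b = 0" by auto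
    then show False using nz a b by auto
  qed
  have "poly ?q (Re z / a + Im z / b) = 0" if z: "z \<in> S" for z
  proof -
    let ?s = "Re z / a + Im z / b"
    have "?s * (Re z / a - Im z / b) = 1" using S[OF z] by (simp add: algebra_simps power2_eq_square)
    then have s0: "?s \<noteq> 0" by auto
    have "poly [:0, 2 * (\<delta> * a - \<epsilon> * b), 4 * \<zeta>, 2 * (\<delta> * a + \<epsilon> * b), 0:] ?s = 0"
      using hyperbola_conic_poly[OF a b S[OF z], of 0 0 0 \<delta> \<epsilon> \<zeta>] Q[OF z] by simp
    moreover have "poly [:0, 2 * (\<delta> * a - \<epsilon> * b), 4 * \<zeta>, 2 * (\<delta> * a + \<epsilon> * b), 0:] s = 2 * s * poly ?q s" for s
      by (simp add: algebra_simps)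
    ultimately have "2 * ?s * poly ?q ?s = 0" by metis
    then show ?thesis using s0 by simp
  qed
  then have "card S \<le> degree ?q" by (intro card_hyperbola_le_degree[OF a b q S])
  also have "\<dots> \<le> 2" by simp
  finally show ?thesis .
qed

text \<open>Coordinates are normalised to put the first pair of foci at -1 and 1. In the two extreme
  cases of \<open>a'\<close> the second locus lies on a line. Otherwise it lies on a hyperbola, and
  proportional equations would force equal foci.\<close>

lemma card_confocal_intersection:
  fixes S :: "complex set" and a a' :: real and C D :: complex
  assumes a: "0 < a" "a < 1" and a': "0 \<le> a'" "2 * a' \<le> cmod (C - D)"
    and CD: "C \<noteq> D" "{C, D} \<noteq> {-1, 1}"
    and S1: "\<And>z. z \<in> S \<Longrightarrow> \<bar>cmod (z + 1) - cmod (z - 1)\<bar> = 2 * a"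
    and S2: "\<And>z. z \<in> S \<Longrightarrow> \<bar>cmod (z - C) - cmod (z - D)\<bar> = 2 * a'"
  shows "card S \<le> (if a' = 0 \<or> 2 * a' = cmod (C - D) then 2 else 4)"
proof -
  define b where "b = sqrt (1 - a\<^sup>2)"
  have "a\<^sup>2 < 1" using a by (simp add: power_less_one_iff)
  then have b: "0 < b" and b2: "b\<^sup>2 = 1 - a\<^sup>2" by (simp_all add: b_def)
  have H: "(Re z)\<^sup>2 / a\<^sup>2 - (Im z)\<^sup>2 / b\<^sup>2 = 1" if z: "z \<in> S" for z
  proof -
    have "(cmod (z + 1) - cmod (z - 1))\<^sup>2 = (2 * a)\<^sup>2"
      using S1[OF z] by (metis power2_abs)
    then have "(Re z)\<^sup>2 = a\<^sup>2 * ((Re z)\<^sup>2 + (Im z)\<^sup>2 + 1 - a\<^sup>2)"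
      using conic_of_distance_difference[of z 0 1 a] by (simp add: power_mult_distrib inner_complex_def cmod_power2)
    then have "(Re z)\<^sup>2 * b\<^sup>2 - (Im z)\<^sup>2 * a\<^sup>2 = a\<^sup>2 * b\<^sup>2" unfolding b2 by (simp add: algebra_simps)
    then show ?thesis using a b by (simp add: field_simps)
  qed
  \<comment> \<open>Centre \<open>(p, q)\<close> and half focal vector \<open>(v1, v2)\<close> of
    the second conic.\<close>
  define p q v1 v2 where "p = Re ((C + D) / 2)" and "q = Im ((C + D) / 2)"
    and "v1 = Re ((D - C) / 2)" and "v2 = Im ((D - C) / 2)"
  have CD_eq: "C = Complex (p - v1) (q - v2)" "D = Complex (p + v1) (q + v2)"
    by (simp_all add: complex_eq_iff p_def q_def v1_def v2_def field_simps)
  have v0: "v1 \<noteq> 0 \<or> v2 \<noteq> 0" using CD(1) by (auto simp: CD_eq)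
  have len: "(cmod (C - D))\<^sup>2 = 4 * (v1\<^sup>2 + v2\<^sup>2)"
    by (simp add: CD_eq cmod_power2)
  have Q: "((Re z - p) * v1 + (Im z - q) * v2)\<^sup>2
      = a'\<^sup>2 * ((Re z - p)\<^sup>2 + (Im z - q)\<^sup>2 + v1\<^sup>2 + v2\<^sup>2 - a'\<^sup>2)" if z: "z \<in> S" for z
  proof -
    have "(cmod (z - C) - cmod (z - D))\<^sup>2 = (2 * a')\<^sup>2" using S2[OF z] by (metis power2_abs)
    moreover have "C = Complex p q - Complex v1 v2" "D = Complex p q + Complex v1 v2"
      by (simp_all add: CD_eq complex_eq_iff)
    ultimately show ?thesis
      using conic_of_distance_difference[of z "Complex p q" "Complex v1 v2" a']
      by (simp add: power_mult_distrib inner_complex_def cmod_power2 algebra_simps)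
  qed
  show ?thesis
  proof (cases "a' = 0 \<or> 2 * a' = cmod (C - D)")
    case True
    have "card S \<le> 2"
    proof (cases "a' = 0")
      case True
      show ?thesis
      proof (rule card_hyperbola_line[OF a(1) b H, where \<delta> = v1 and \<epsilon> = v2 and \<zeta> = "- p * v1 - q * v2"])
        fix z assume "z \<in> S"
        from Q[OF this] show "v1 * Re z + v2 * Im z + (- p * v1 - q * v2) = 0"
          using True by (simp add: algebra_simps)
      qed (use v0 in auto)
    next
      case False
      then have "2 * a' = cmod (C - D)" using True by simp
      then have "(2 * a')\<^sup>2 = 4 * (v1\<^sup>2 + v2\<^sup>2)" using len by simp
      then have a2: "a'\<^sup>2 = v1\<^sup>2 + v2\<^sup>2" by (simp add: power_mult_distrib)
      show ?thesis
      \<comment> \<open>At \<open>a'\<^sup>2 = v1\<^sup>2 + v2\<^sup>2\<close> the conic degenerates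
        to the square of this linear form, the line \<open>CD\<close> counted twice.\<close>
      proof (rule card_hyperbola_line[OF a(1) b H, where \<delta> = v2 and \<epsilon> = "- v1" and \<zeta> = "- p * v2 + q * v1"])
        fix z assume "z \<in> S"
        from Q[OF this] have "((Re z - p) * v2 - (Im z - q) * v1)\<^sup>2 = 0"
          unfolding a2 by (simp add: power2_eq_square algebra_simps)
        then show "v2 * Re z + - v1 * Im z + (- p * v2 + q * v1) = 0" by (simp add: algebra_simps)
      qed (use v0 in auto)
    qed
    then show ?thesis using True by simp
  next
    case False
    then have a0: "0 < a'" and "2 * a' < cmod (C - D)" using a' by auto
    then have "(2 * a')\<^sup>2 < (cmod (C - D))\<^sup>2" by (intro power_strict_mono) auto
    then have av: "a'\<^sup>2 < v1\<^sup>2 + v2\<^sup>2" unfolding len by (simp add: power_mult_distrib)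
    have "card S \<le> 4"
    proof (rule card_hyperbola_conic[OF a(1) b H, where
          \<alpha> = "v1\<^sup>2 - a'\<^sup>2" and \<beta> = "2 * v1 * v2" and \<gamma> = "v2\<^sup>2 - a'\<^sup>2"
          and \<delta> = "2 * a'\<^sup>2 * p - 2 * (p * v1 + q * v2) * v1"
          and \<epsilon> = "2 * a'\<^sup>2 * q - 2 * (p * v1 + q * v2) * v2"
          and \<zeta> = "(p * v1 + q * v2)\<^sup>2 - a'\<^sup>2 * (p\<^sup>2 + q\<^sup>2 + v1\<^sup>2 + v2\<^sup>2 - a'\<^sup>2)"])
      fix z assume "z \<in> S"
      from Q[OF this] show "(v1\<^sup>2 - a'\<^sup>2) * (Re z)\<^sup>2 + 2 * v1 * v2 * Re z * Im z + (v2\<^sup>2 - a'\<^sup>2) * (Im z)\<^sup>2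
          + (2 * a'\<^sup>2 * p - 2 * (p * v1 + q * v2) * v1) * Re z
          + (2 * a'\<^sup>2 * q - 2 * (p * v1 + q * v2) * v2) * Im z
          + ((p * v1 + q * v2)\<^sup>2 - a'\<^sup>2 * (p\<^sup>2 + q\<^sup>2 + v1\<^sup>2 + v2\<^sup>2 - a'\<^sup>2)) = 0"
        by (simp add: power2_eq_square algebra_simps)
    next
      show "\<not> (2 * v1 * v2 = 0 \<and> 2 * a'\<^sup>2 * p - 2 * (p * v1 + q * v2) * v1 = 0 \<and>
          2 * a'\<^sup>2 * q - 2 * (p * v1 + q * v2) * v2 = 0 \<and>
          (v1\<^sup>2 - a'\<^sup>2) * a\<^sup>2 = - ((p * v1 + q * v2)\<^sup>2 - a'\<^sup>2 * (p\<^sup>2 + q\<^sup>2 + v1\<^sup>2 + v2\<^sup>2 - a'\<^sup>2)) \<and>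
          (v2\<^sup>2 - a'\<^sup>2) * b\<^sup>2 = (p * v1 + q * v2)\<^sup>2 - a'\<^sup>2 * (p\<^sup>2 + q\<^sup>2 + v1\<^sup>2 + v2\<^sup>2 - a'\<^sup>2))"
        (is "\<not> (?B \<and> ?D \<and> ?E \<and> ?X \<and> ?Y)")
      proof
        assume *: "?B \<and> ?D \<and> ?E \<and> ?X \<and> ?Y"
        \<comment> \<open>The vanishing mixed term makes the axes parallel to the coordinate axes,
          and the linear terms then put the centre at 0. A horizontal focal vector yields
          \<open>a' = a\<close> and foci -1, 1; a vertical one yields a sign contradiction.\<close>
        then consider "v2 = 0" "v1 \<noteq> 0" | "v1 = 0" "v2 \<noteq> 0" using v0 by auto
        then show False
        proof cases
          case 1
          have "p * (a'\<^sup>2 - v1\<^sup>2) = 0" "q * a'\<^sup>2 = 0" using * 1 by (simp_all add: power2_eq_square algebra_simps)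
          then have pq: "p = 0" "q = 0" using av 1 a0 by auto
          have "(v1\<^sup>2 - a'\<^sup>2) * (a\<^sup>2 - a'\<^sup>2) = 0" using * 1 pq by (simp add: power2_eq_square algebra_simps)
          then have aa: "a'\<^sup>2 = a\<^sup>2" using av 1 by simp
          have "a'\<^sup>2 * b\<^sup>2 = a'\<^sup>2 * (v1\<^sup>2 - a'\<^sup>2)" using * 1 pq by (simp add: power2_eq_square algebra_simps)
          then have "b\<^sup>2 = v1\<^sup>2 - a\<^sup>2" using a0 by (simp add: aa[symmetric])
          then have "v1\<^sup>2 = 1" using b2 by simp
          then have "v1 = 1 \<or> v1 = -1" by (simp add: power2_eq_1_iff)
          then have "{C, D} = {-1, 1}" using pq 1 by (auto simp: CD_eq complex_eq_iff)
          then show False using CD by simp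
        next
          case 2
          have "q * (a'\<^sup>2 - v2\<^sup>2) = 0" "p * a'\<^sup>2 = 0" using * 2 by (simp_all add: power2_eq_square algebra_simps)
          then have pq: "p = 0" "q = 0" using av 2 a0 by auto
          have "a'\<^sup>2 * a\<^sup>2 = - (a'\<^sup>2 * (v2\<^sup>2 - a'\<^sup>2))" using * 2 pq by (simp add: power2_eq_square algebra_simps)
          moreover have "0 < a'\<^sup>2 * a\<^sup>2" "0 < a'\<^sup>2 * (v2\<^sup>2 - a'\<^sup>2)" using a a0 av 2 by auto
          ultimately show False by linarith
        qed
      qed
    qed
    then show ?thesis using False by simp
  qed
qed

text \<open>The similarity \<open>f\<close> sends \<open>A\<close>, \<open>B\<close> to -1, 1 and
  scales by \<open>2 / m1\<close>. By the triangle inequality the distance differences are integers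
  \<open>k <= m1\<close> and \<open>l <= m2\<close>; the values \<open>0 < k < m1\<close> belong to
  hyperbolas, the extremes to the two lines counted separately.\<close>

lemma card_le_intersections:
  fixes M :: "complex set" and m1 m2 :: nat
  assumes fin: "finite M" and AB: "A \<noteq> B" "A \<in> M" "B \<in> M" and CD: "C \<noteq> D" "C \<in> M" "D \<in> M"
    and ne: "{C, D} \<noteq> {A, B}" and m1: "dist A B = real m1" and m2: "dist C D = real m2"
    and int: "\<And>P Q. P \<in> M \<Longrightarrow> Q \<in> M \<Longrightarrow> dist P Q \<in> \<int>"
  defines "f \<equiv> \<lambda>z. (z - (A + B) / 2) / ((B - A) / 2)"
  shows "card M \<le> 4 * m2 * (m1 - 1) + card {z \<in> M. Re (f z) = 0} + card {z \<in> M. Im (f z) = 0}"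
proof -
  have m0: "0 < m1" "0 < m2" using AB(1) CD(1) m1 m2 by (metis dist_pos_lt of_nat_0_less_iff)+
  have w0: "(B - A) / 2 \<noteq> 0" using AB by simp
  have wn: "cmod ((B - A) / 2) = real m1 / 2" using m1 by (simp add: dist_norm norm_divide norm_minus_commute)
  have fd: "f z - f y = (z - y) / ((B - A) / 2)" for z y by (simp add: f_def diff_divide_distrib)
  have fn: "cmod (f z - f y) = dist z y * (2 / m1)" for z y
  proof -
    have "cmod (f z - f y) = cmod (z - y) / cmod ((B - A) / 2)" unfolding fd by (rule norm_divide)
    then show ?thesis unfolding wn by (simp add: dist_norm)
  qed
  have fA: "f A = -1" and fB: "f B = 1" using AB by (simp_all add: f_def field_simps)
  have inj: "inj f" by (rule injI) (use AB in \<open>simp add: f_def\<close>)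
  define H where "H k l = {z \<in> M. \<bar>dist z A - dist z B\<bar> = real k \<and> \<bar>dist z C - dist z D\<bar> = real l}" for k l
  have H_card: "card (H k l) \<le> (if l = 0 \<or> l = m2 then 2 else 4)" if k: "k \<in> {1..<m1}" and l: "l \<in> {0..m2}" for k l
  proof -
    have "card (f ` H k l) \<le> (if real l / m1 = 0 \<or> 2 * (real l / m1) = cmod (f C - f D) then 2 else 4)"
    proof (rule card_confocal_intersection[where a = "real k / m1"])
      show "f C \<noteq> f D" using CD(1) inj by (simp add: inj_eq)
      have "f ` {C, D} \<noteq> f ` {A, B}" using ne by (simp only: inj_image_eq_iff[OF inj] not_False_eq_True)
      then show "{f C, f D} \<noteq> {-1, 1}" by (simp add: fA fB)
      show "2 * (real l / m1) \<le> cmod (f C - f D)"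
        using l m0 by (simp add: fn m2 divide_right_mono)
    next
      fix z assume "z \<in> f ` H k l"
      then obtain y where z: "z = f y" and y: "\<bar>dist y A - dist y B\<bar> = real k" "\<bar>dist y C - dist y D\<bar> = real l"
        by (auto simp: H_def)
      have "\<bar>cmod (f y - f A) - cmod (f y - f B)\<bar> = real k * (2 / m1)"
        unfolding fn y(1)[symmetric] left_diff_distrib[symmetric] abs_mult by simp
      then show "\<bar>cmod (z + 1) - cmod (z - 1)\<bar> = 2 * (real k / m1)" by (simp add: z fA fB)
      have "\<bar>cmod (f y - f C) - cmod (f y - f D)\<bar> = real l * (2 / m1)"
        unfolding fn y(2)[symmetric] left_diff_distrib[symmetric] abs_mult by simp
      then show "\<bar>cmod (z - f C) - cmod (z - f D)\<bar> = 2 * (real l / m1)" by (simp add: z)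
    qed (use k m0 in auto)
    also have "\<dots> = (if l = 0 \<or> l = m2 then 2 else 4)"
      using m0 by (simp add: fn m2)
    finally show ?thesis by (simp add: card_image[OF inj_on_subset[OF inj]])
  qed
  have sub: "M \<subseteq> (\<Union>k\<in>{1..<m1}. \<Union>l\<in>{0..m2}. H k l) \<union> {z \<in> M. Re (f z) = 0} \<union> {z \<in> M. Im (f z) = 0}"
  proof
    fix z assume z: "z \<in> M"
    have ex: "\<exists>k::nat. \<bar>dist z P - dist z Q\<bar> = real k \<and> k \<le> m" if "P \<in> M" "Q \<in> M" "dist P Q = real m" for P Q m
    proof -
      have "\<bar>dist z P - dist z Q\<bar> \<in> \<int>" using int[OF z] that by auto
      then obtain j where j: "\<bar>dist z P - dist z Q\<bar> = of_int j" by (auto elim: Ints_cases)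
      then have j0: "0 \<le> j" by (metis abs_ge_zero of_int_0_le_iff)
      have "\<bar>dist z P - dist z Q\<bar> \<le> dist P Q" using abs_dist_diff_le[of P z Q] by (simp add: dist_commute)
      then show ?thesis using that(3) j j0 by (intro exI[of _ "nat j"]) auto
    qed
    obtain k where k: "\<bar>dist z A - dist z B\<bar> = real k" "k \<le> m1" using ex[OF AB(2,3) m1] by blast
    obtain l where l: "\<bar>dist z C - dist z D\<bar> = real l" "l \<le> m2" using ex[OF CD(2,3) m2] by blast
    have "\<bar>cmod (f z - f A) - cmod (f z - f B)\<bar> = real k * (2 / m1)"
      unfolding fn k(1)[symmetric] left_diff_distrib[symmetric] abs_mult by simp
    then have "(cmod (f z + 1) - cmod (f z - 1))\<^sup>2 = (real k * (2 / m1))\<^sup>2"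
      unfolding fA fB by (metis diff_minus_eq_add power2_abs)
    also have "\<dots> = 4 * (real k / m1)\<^sup>2" by (simp add: power2_eq_square)
    finally have e: "(Re (f z))\<^sup>2 = (real k / m1)\<^sup>2 * ((Re (f z))\<^sup>2 + (Im (f z))\<^sup>2 + 1 - (real k / m1)\<^sup>2)"
      using conic_of_distance_difference[of "f z" 0 1 "real k / m1"] by (simp add: inner_complex_def cmod_power2)
    \<comment> \<open>In \<open>e\<close>, \<open>k = 0\<close> leaves \<open>Re (f z) = 0\<close>
      and \<open>k = m1\<close> leaves \<open>Im (f z) = 0\<close>.\<close>
    consider "k = 0" | "k = m1" | "k \<in> {1..<m1}" using k(2) by fastforce
    then show "z \<in> (\<Union>k\<in>{1..<m1}. \<Union>l\<in>{0..m2}. H k l) \<union> {z \<in> M. Re (f z) = 0} \<union> {z \<in> M. Im (f z) = 0}"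
    proof cases
      case 1
      then show ?thesis using e z by simp
    next
      case 2
      then show ?thesis using e z m0 by simp
    next
      case 3
      then show ?thesis using z k l by (auto simp: H_def)
    qed
  qed
  have fH: "finite (H k l)" for k l using fin by (simp add: H_def)
  have "card (\<Union>k\<in>{1..<m1}. \<Union>l\<in>{0..m2}. H k l) \<le> (\<Sum>k\<in>{1..<m1}. card (\<Union>l\<in>{0..m2}. H k l))"
    by (rule card_UN_le) simp
  also have "\<dots> \<le> (\<Sum>k\<in>{1..<m1}. \<Sum>l\<in>{0..m2}. card (H k l))" by (intro sum_mono card_UN_le) simp
  also have "\<dots> \<le> (\<Sum>k\<in>{1..<m1}. \<Sum>l\<in>{0..m2}. (if l = 0 \<or> l = m2 then 2 else 4))"
    by (intro sum_mono H_card)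
  also have "(\<Sum>l\<in>{0..m2}. (if l = 0 \<or> l = m2 then 2 else 4)) = 4 * m2"
  proof -
    \<comment> \<open>The bisector and the line \<open>CD\<close> contribute 2 each, the
      \<open>m2 - 1\<close> hyperbolas 4 each.\<close>
    have eq: "{0..m2} = insert 0 (insert m2 {1..<m2})" using m0 by auto
    have "(\<Sum>l\<in>{1..<m2}. (if l = 0 \<or> l = m2 then 2 else 4)) = (\<Sum>l\<in>{1..<m2}. 4)"
      by (intro sum.cong) auto
    then show ?thesis unfolding eq using m0 by simp
  qed
  also have "(\<Sum>k\<in>{1..<m1}. 4 * m2) = 4 * m2 * (m1 - 1)" by simp
  finally have U: "card (\<Union>k\<in>{1..<m1}. \<Union>l\<in>{0..m2}. H k l) \<le> 4 * m2 * (m1 - 1)" .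
  have "card M \<le> card ((\<Union>k\<in>{1..<m1}. \<Union>l\<in>{0..m2}. H k l) \<union> {z \<in> M. Re (f z) = 0} \<union> {z \<in> M. Im (f z) = 0})"
    by (rule card_mono[OF _ sub]) (use fin fH in auto)
  also have "\<dots> \<le> card (\<Union>k\<in>{1..<m1}. \<Union>l\<in>{0..m2}. H k l) + card {z \<in> M. Re (f z) = 0} + card {z \<in> M. Im (f z) = 0}"
    by (meson add_le_mono1 card_Un_le order_trans)
  finally show ?thesis using U by linarith
qed

subsection \<open>Integral point sets in the plane\<close>

lemma ex_dist_minimal:
  fixes X :: "('a::metric_space \<times> 'a) set"
  assumes "finite X" "X \<noteq> {}"
  obtains x y where "(x, y) \<in> X" "\<And>u v. (u, v) \<in> X \<Longrightarrow> dist x y \<le> dist u v"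
proof -
  obtain e where "is_arg_min (\<lambda>(x, y). dist x y) (\<lambda>e. e \<in> X) e"
    using ex_is_arg_min_if_finite[OF assms] by blast
  then have "e \<in> X" "\<And>f. f \<in> X \<Longrightarrow> dist (fst e) (snd e) \<le> dist (fst f) (snd f)"
    by (simp_all add: is_arg_min_linorder case_prod_beta)
  then show ?thesis using that[of "fst e" "snd e"] by fastforce
qed

lemma planar_integral_points_bound:
  fixes M :: "complex set"
  assumes fin: "finite M" and n: "3 \<le> card M"
    and int: "\<And>P Q. P \<in> M \<Longrightarrow> Q \<in> M \<Longrightarrow> dist P Q \<in> \<int>"
    and diam: "\<And>P Q. P \<in> M \<Longrightarrow> Q \<in> M \<Longrightarrow> dist P Q \<le> real p"
    and off: "\<And>A B. A \<in> M \<Longrightarrow> B \<in> M \<Longrightarrow> A \<noteq> B \<Longrightarrow> \<exists>P\<in>M. Im ((P - A) / (B - A)) \<noteq> 0"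
  shows "100 * (real (card M) - 2) \<le> 219 * real p"
proof -
  have nat_dist: "\<exists>k::nat. dist P Q = real k" if "P \<in> M" "Q \<in> M" for P Q
    using int[OF that] zero_le_dist[of P Q] by (metis Ints_cases of_int_0_le_iff of_nat_nat of_int_of_nat_eq)
  \<comment> \<open>Pairs are ordered, so excluding the closest pair later means removing both
    orders.\<close>
  define X where "X = {(P, Q). P \<in> M \<and> Q \<in> M \<and> P \<noteq> Q}"
  have finX: "finite X" by (rule finite_subset[of _ "M \<times> M"]) (use fin in \<open>auto simp: X_def\<close>)
  obtain x y z where xyz: "x \<in> M" "y \<in> M" "z \<in> M" "x \<noteq> y" "x \<noteq> z" "y \<noteq> z"
    using n by (auto simp: numeral_3_eq_3 card_le_Suc_iff)
  then have "X \<noteq> {}" by (auto simp: X_def)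
  from ex_dist_minimal[OF finX this] obtain A B where AB: "(A, B) \<in> X"
    and ABmin: "\<And>u v. (u, v) \<in> X \<Longrightarrow> dist A B \<le> dist u v" by metis
  have AB': "A \<in> M" "B \<in> M" "A \<noteq> B" using AB by (auto simp: X_def)
  have "(x, y) \<in> X \<and> (x, z) \<in> X" using xyz by (auto simp: X_def)
  then have "X - {(A, B), (B, A)} \<noteq> {}" using xyz by auto
  moreover have "finite (X - {(A, B), (B, A)})" using finX by simp
  ultimately obtain C D where CD: "(C, D) \<in> X - {(A, B), (B, A)}"
    and CDmin: "\<And>u v. (u, v) \<in> X - {(A, B), (B, A)} \<Longrightarrow> dist C D \<le> dist u v"
    using ex_dist_minimal by metis
  have CD': "C \<in> M" "D \<in> M" "C \<noteq> D" "{C, D} \<noteq> {A, B}" using CD by (auto simp: X_def doubleton_eq_iff)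
  obtain m1 where m1: "dist A B = real m1" using nat_dist AB' by blast
  obtain m2 where m2: "dist C D = real m2" using nat_dist CD' by blast
  have m0: "0 < m1" using AB' m1 by (metis dist_pos_lt of_nat_0_less_iff)
  have m12: "m1 \<le> m2" using ABmin[of C D] CD m1 m2 by simp
  have p1: "1 \<le> p" using diam[OF AB'(1,2)] m1 m0 by simp
  have lo: "real m1 \<le> dist P Q" if "P \<in> M" "Q \<in> M" "P \<noteq> Q" for P Q
    using ABmin[of P Q] that m1 by (simp add: X_def)
  have pack1: "real (card M) * (real m1)\<^sup>2 \<le> (real p + real m1)\<^sup>2"
    by (rule packing) (use fin m0 lo diam in auto)
  \<comment> \<open>Deleting \<open>A\<close> destroys the closest pair, so all remaining distances
    are at least \<open>m2\<close>.\<close>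
  have "real (card (M - {A})) * (real m2)\<^sup>2 \<le> (real p + real m2)\<^sup>2"
  proof (rule packing)
    fix u v assume "u \<in> M - {A}" "v \<in> M - {A}" "u \<noteq> v"
    then have "(u, v) \<in> X - {(A, B), (B, A)}" by (auto simp: X_def)
    then show "real m2 \<le> dist u v" using CDmin m2 by simp
  qed (use fin m0 m12 diam in auto)
  moreover have "real (card (M - {A})) = real (card M) - 1"
    using fin AB' n by (simp add: card_Diff_singleton of_nat_diff)
  ultimately have pack2: "(real (card M) - 1) * (real m2)\<^sup>2 \<le> (real p + real m2)\<^sup>2" by simp
  define c w where "c = (A + B) / 2" and "w = (B - A) / 2"
  have w0: "w \<noteq> 0" using AB' by (simp add: w_def)
  let ?L1 = "{z \<in> M. Re ((z - c) / w) = 0}" and ?L2 = "{z \<in> M. Im ((z - c) / w) = 0}"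
  \<comment> \<open>This presents the bisector as the line through \<open>c\<close> with direction
    \<open>\<i> * w\<close>, to which \<open>collinear_integral_bounds\<close> applies;
    \<open>A\<close> serves as the point off it.\<close>
  have rot: "Im ((z - c) / (\<i> * w)) = - Re ((z - c) / w)" for z
  proof -
    have "(z - c) / (\<i> * w) = (z - c) / w / \<i>" by (simp only: divide_divide_eq_left mult.commute)
    moreover have "Im (u / \<i>) = - Re u" for u by simp
    ultimately show ?thesis by (simp only:)
  qed
  have "Re ((A - c) / w) \<noteq> 0"
  proof -
    have "(A - c) / w = -1" using w0 by (simp add: c_def w_def field_simps)
    then show ?thesis by simp
  qed
  moreover have "\<exists>P\<in>M. Im ((P - c) / w) \<noteq> 0"
  proof -
    obtain P where P: "P \<in> M" "Im ((P - A) / (B - A)) \<noteq> 0" using off AB' by blast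
    have "(P - c) / w = 2 * ((P - A) / (B - A)) - 1"
      using AB' by (simp add: c_def w_def field_simps)
    then have "Im ((P - c) / w) = 2 * Im ((P - A) / (B - A))" by (simp only: minus_complex.sel times_complex.sel) simp
    then show ?thesis using P by (intro bexI[of _ P]) auto
  qed
  then obtain P where "P \<in> M" "Im ((P - c) / w) \<noteq> 0" by blast
  ultimately show ?thesis
  proof (intro integral_point_count_arith[OF _ m12 p1 pack1 pack2, of "card ?L1" "card ?L2"])
    show "card M \<le> 4 * m2 * (m1 - 1) + card ?L1 + card ?L2"
      unfolding c_def w_def
      by (rule card_le_intersections) (use fin AB' CD' m1 m2 int in auto)
    show "real m1 * (real (card ?L1) - 1) \<le> real p"
      by (rule collinear_integral_bounds(1)[where w = "\<i> * w" and c = c]) (use fin w0 m0 lo diam rot in auto)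
    show "real m1 * (real (card ?L2) - 1) \<le> real p"
      by (rule collinear_integral_bounds(1)[where w = w and c = c]) (use fin w0 m0 lo diam in auto)
    show "m1 * (2 * m1 - 1) < p" if "Re ((A - c) / w) \<noteq> 0" "card ?L1 = 2 * m1" "2 \<le> m1"
      by (rule collinear_integral_bounds(2)[where w = "\<i> * w" and c = c and P = A and L = ?L1])
        (use fin w0 m0 lo diam rot that int AB' in auto)
    show "m1 * (2 * m1 - 1) < p" if "P \<in> M" "Im ((P - c) / w) \<noteq> 0" "card ?L2 = 2 * m1" "2 \<le> m1"
      by (rule collinear_integral_bounds(2)[where w = w and c = c and P = P and L = ?L2])
        (use fin w0 m0 lo diam that int in auto)
  qed (use m0 in auto)
qed

text \<open>In \<open>complex\<close>, similarities are divisions. If every point had a real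
  quotient with respect to some \<open>a\<close>, \<open>b\<close>, then \<open>M\<close> would lie
  in the line \<open>affine hull {a, b}\<close>.\<close>

lemma integral_point_set_card_le:
  fixes M :: "(real ^ 2) set"
  assumes M: "integral_point_set M" and n: "3 \<le> card M" and diam: "diameter M = real p"
  shows "100 * (real (card M) - 2) \<le> 219 * real p"
proof -
  define f where "f x = Complex (x $ 1) (x $ 2)" for x :: "real ^ 2"
  have fin: "finite M" and int: "\<And>A B. A \<in> M \<Longrightarrow> B \<in> M \<Longrightarrow> dist A B \<in> \<int>"
    and nc: "\<not> (\<exists>H :: (real ^ 2) set. affine H \<and> aff_dim H = 1 \<and> M \<subseteq> H)"
    using M by (auto simp: integral_point_set_def)
  have ds: "dist (f x) (f y) = dist x y" for x y
    by (simp add: f_def dist_norm cmod_def norm_vec_def L2_set_def sum_2)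
  have inj: "inj f" by (metis injI ds dist_eq_0_iff)
  have card: "card (f ` M) = card M" by (rule card_image) (rule inj_on_subset[OF inj], simp)
  have "100 * (real (card (f ` M)) - 2) \<le> 219 * real p"
  proof (rule planar_integral_points_bound)
    fix A B assume "A \<in> f ` M" "B \<in> f ` M" "A \<noteq> B"
    then obtain a b where ab: "a \<in> M" "b \<in> M" "a \<noteq> b" "A = f a" "B = f b" by auto
    show "\<exists>P\<in>f ` M. Im ((P - A) / (B - A)) \<noteq> 0"
    proof (rule ccontr)
      assume "\<not> ?thesis"
      then have z: "Im ((f x - f a) / (f b - f a)) = 0" if "x \<in> M" for x using that ab by auto
      have "x \<in> affine hull {a, b}" if x: "x \<in> M" for x
      proof -
        define t where "t = Re ((f x - f a) / (f b - f a))"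
        have "(f x - f a) / (f b - f a) = of_real t" using z[OF x] by (simp add: t_def complex_eq_iff)
        moreover have "f b - f a \<noteq> 0" using ab inj by (simp add: inj_eq)
        ultimately have "f x - f a = of_real t * (f b - f a)" by (simp add: divide_eq_eq)
        then have "x $ 1 - a $ 1 = t * (b $ 1 - a $ 1)" "x $ 2 - a $ 2 = t * (b $ 2 - a $ 2)"
          by (simp_all add: f_def complex_eq_iff)
        then have "x = (1 - t) *\<^sub>R a + t *\<^sub>R b" by (simp add: vec_eq_iff forall_2 algebra_simps)
        moreover have "(1 - t) + t = 1" by simp
        ultimately show ?thesis unfolding affine_hull_2 by blast
      qed
      then have "M \<subseteq> affine hull {a, b}" by blast
      moreover have "aff_dim (affine hull {a, b}) = 1" using ab by (simp add: aff_dim_2)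
      ultimately show False using nc affine_affine_hull by blast
    qed
  next
    fix P Q assume "P \<in> f ` M" "Q \<in> f ` M"
    then obtain x y where xy: "x \<in> M" "y \<in> M" "P = f x" "Q = f y" by auto
    then show "dist P Q \<in> \<int>" by (simp add: ds int)
    show "dist P Q \<le> real p"
      using diameter_bounded_bound[OF finite_imp_bounded[OF fin] xy(1,2)] by (simp add: xy ds diam)
  qed (use fin n card in auto)
  then show ?thesis by (simp add: card)
qed

section \<open>Existence of the minimum diameter\<close>

lemma diameter_integral_point_set:
  assumes "integral_point_set M" "M \<noteq> {}"
  shows "\<exists>k::nat. diameter M = real k"
proof -
  have fin: "finite M" and int: "\<And>A B. A \<in> M \<Longrightarrow> B \<in> M \<Longrightarrow> dist A B \<in> \<int>"
    using assms(1) by (auto simp: integral_point_set_def)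
  obtain x y where "x \<in> M" "y \<in> M" "dist x y = diameter M"
    using diameter_compact_attained[OF finite_imp_compact[OF fin] assms(2)] by blast
  then show ?thesis using int zero_le_dist[of x y]
    by (metis Ints_cases of_int_0_le_iff of_nat_nat of_int_of_nat_eq)
qed

text \<open>The factorisations \<open>2^i * 2^(2N - i)\<close> of \<open>(2^N)\<^sup>2\<close> yield Pythagorean triangles with
  the common leg \<open>2^N\<close>.\<close>
lemma integral_point_set_exists:
  assumes n: "3 \<le> n"
  shows "\<exists>M :: (real ^ 2) set. integral_point_set M \<and> card M = n"
proof -
  \<comment> \<open>\<open>N\<close> points on the horizontal axis and the apex \<open>P\<close> off
    it.\<close>
  define N where "N = n - 1"
  \<comment> \<open>Half the difference and half the sum of the two factors; the truncated
    subtractions are exact for \<open>1 \<le> i \<le> N\<close>.\<close>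
  define x c :: "nat \<Rightarrow> real" where "x i = 2 ^ (2 * N - i - 1) - 2 ^ (i - 1)"
    and "c i = 2 ^ (2 * N - i - 1) + 2 ^ (i - 1)" for i
  define S where "S = (\<lambda>i. vector [x i, 0] :: real ^ 2) ` {1..N}"
  define P :: "real ^ 2" where "P = vector [0, 2 ^ N]"
  have x_mono: "x j < x i" if "i < j" "j \<le> N" for i j
  proof -
    have "(2::real) ^ (2 * N - j - 1) \<le> 2 ^ (2 * N - i - 1)" by (rule power_increasing) (use that in auto)
    moreover have "(2::real) ^ (2 * N - j - 1) < 2 ^ (2 * N - i - 1)" using that by (intro power_strict_increasing) auto
    moreover have "(2::real) ^ (i - 1) \<le> 2 ^ (j - 1)" by (rule power_increasing) (use that in auto)
    ultimately show ?thesis unfolding x_def by linarith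
  qed
  have xinj: "inj_on x {1..N}"
    by (rule inj_onI) (metis atLeastAtMost_iff linorder_neqE_nat order_less_irrefl x_mono)
  have inj: "inj_on (\<lambda>i. vector [x i, 0] :: real ^ 2) {1..N}"
  proof (rule inj_onI)
    fix i j assume ij: "i \<in> {1..N}" "j \<in> {1..N}" and "(vector [x i, 0] :: real ^ 2) = vector [x j, 0]"
    then have "(vector [x i, 0] :: real ^ 2) $ 1 = (vector [x j, 0] :: real ^ 2) $ 1" by (simp only:)
    then show "i = j" using xinj ij by (simp add: inj_on_eq_iff)
  qed
  have dx: "dist (vector [x i, 0] :: real ^ 2) (vector [x j, 0]) = \<bar>x i - x j\<bar>" for i j
    by (simp add: dist_norm norm_vec_def L2_set_def sum_2)
  have dP: "dist P (vector [x i, 0]) = c i" if i: "i \<in> {1..N}" for i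
  proof -
    have "(2::real) ^ (2 * N - i - 1) * 2 ^ (i - 1) * 4 = 2 ^ (2 * N)"
    proof -
      have "(2::real) ^ (2 * N - i - 1) * 2 ^ (i - 1) * 4 = 2 ^ (2 * N - i - 1 + (i - 1) + 2)"
        by (simp only: power_add) simp
      also have "2 * N - i - 1 + (i - 1) + 2 = 2 * N" using i unfolding atLeastAtMost_iff by linarith
      finally show ?thesis .
    qed
    moreover have "(c i)\<^sup>2 = (x i)\<^sup>2 + 2 ^ (2 * N - i - 1) * 2 ^ (i - 1) * 4"
      unfolding x_def c_def power2_diff power2_sum by linarith
    ultimately have "(x i)\<^sup>2 + (2 ^ N)\<^sup>2 = (c i)\<^sup>2" by (simp only: power_even_eq)
    moreover have "0 \<le> c i" by (simp add: c_def)
    ultimately show ?thesis by (simp add: P_def dist_norm norm_vec_def L2_set_def sum_2)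
  qed
  have Z: "x i \<in> \<int>" "c i \<in> \<int>" for i by (simp_all add: x_def c_def)
  have PS: "P \<notin> S" by (auto simp: P_def S_def vec_eq_iff forall_2)
  have "card S = N" unfolding S_def card_image[OF inj] by simp
  moreover have "finite S" by (simp add: S_def)
  ultimately have card: "card (insert P S) = n"
    using n PS by (simp add: N_def)
  have "integral_point_set (insert P S)"
    unfolding integral_point_set_def
  proof (intro conjI)
    show "finite (insert P S)" by (simp add: S_def)
    show "\<forall>A\<in>insert P S. \<forall>B\<in>insert P S. dist A B \<in> \<int>"
      using Z by (auto simp: S_def dx dP dist_commute[of _ P])
    show "\<not> (\<exists>H :: (real ^ 2) set. affine H \<and> aff_dim H = int CARD(2) - 1 \<and> insert P S \<subseteq> H)"
    proof
      assume "\<exists>H :: (real ^ 2) set. affine H \<and> aff_dim H = int CARD(2) - 1 \<and> insert P S \<subseteq> H"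
      then obtain H :: "(real ^ 2) set" where H: "affine H" "aff_dim H = 1" "insert P S \<subseteq> H" by auto
      let ?a = "vector [x 1, 0] :: real ^ 2" and ?b = "vector [x 2, 0] :: real ^ 2"
      have N2: "2 \<le> N" using n by (simp add: N_def)
      have xx: "x 2 < x 1" by (rule x_mono) (use N2 in auto)
      have ab: "?a \<in> H" "?b \<in> H" "P \<in> H" using H N2 by (auto simp: S_def)
      have ne: "?a \<noteq> ?b" using xx by (auto simp: vec_eq_iff forall_2)
      \<comment> \<open>Two points on the axis already determine \<open>H\<close>, which then misses
        \<open>P\<close>.\<close>
      have "affine hull {?a, ?b} = H"
      proof (rule affine_dim_equal)
        show "affine hull {?a, ?b} \<subseteq> H" by (rule hull_minimal) (use ab H in auto)
        show "aff_dim (affine hull {?a, ?b}) = aff_dim H" using ne H by (simp add: aff_dim_2)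
      qed (use H in auto)
      then have "P \<in> affine hull {?a, ?b}" using ab by simp
      then obtain u v where "P = u *\<^sub>R ?a + v *\<^sub>R ?b" unfolding affine_hull_2 by blast
      then have "P $ 2 = 0" by simp
      then show False by (simp add: P_def)
    qed
  qed
  then show ?thesis using card by blast
qed

theorem theorem3:
  shows "(\<forall>n::nat. n \<ge> 4 \<longrightarrow> min_diameter TYPE(2) n \<ge> gamma * (real n - 2)) \<and>
         (3::real) powr (1/4) * 2 powr (-3/2) > gamma \<and> gamma > 0.45557 \<and> (0.45557::real) > 5/11"
proof (intro conjI allI impI)
  fix n :: nat assume n: "4 \<le> n"
  define Q where "Q r \<longleftrightarrow> (\<exists>M :: (real ^ 2) set. integral_point_set M \<and> card M = n \<and> diameter M = r)" for r
  have Q_nat: "\<exists>k::nat. r = real k" if Qr: "Q r" for r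
  proof -
    obtain M :: "(real ^ 2) set" where M: "integral_point_set M" "card M = n" "diameter M = r"
      using Qr unfolding Q_def by blast
    then have "M \<noteq> {}" using n by auto
    with diameter_integral_point_set[OF M(1)] M(3) show ?thesis by simp
  qed
  obtain M0 :: "(real ^ 2) set" where "integral_point_set M0" "card M0 = n"
    using integral_point_set_exists[of n] n by auto
  then have "Q (diameter M0)" unfolding Q_def by blast
  \<comment> \<open>\<open>Q\<close> holds only at natural numbers, so the real \<open>LEAST\<close>
    exists and equals the one over \<open>nat\<close>.\<close>
  with Q_nat have "\<exists>k::nat. Q (real k)" by metis
  then have k: "Q (real (LEAST k. Q (real k)))" by (rule LeastI_ex)
  have "(LEAST r. Q r) = real (LEAST k. Q (real k))"
  proof (rule Least_equality[where P = Q, OF k])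
    fix r assume "Q r"
    moreover obtain j where "r = real j" using Q_nat[OF \<open>Q r\<close>] by blast
    ultimately show "real (LEAST k. Q (real k)) \<le> r" by (simp add: Least_le)
  qed
  then have min: "min_diameter TYPE(2) n = real (LEAST k. Q (real k))"
    by (simp add: min_diameter_def Q_def)
  obtain M :: "(real ^ 2) set" where M: "integral_point_set M" "card M = n"
    "diameter M = real (LEAST k. Q (real k))" using k unfolding Q_def by blast
  have "gamma * (real n - 2) \<le> 100 / 219 * (real n - 2)"
    using gamma_upper n by (intro mult_right_mono) auto
  also have "\<dots> \<le> min_diameter TYPE(2) n"
    using integral_point_set_card_le[OF M(1) _ M(3)] n M(2) by (simp add: min)
  finally show "gamma * (real n - 2) \<le> min_diameter TYPE(2) n" .
qed (use gamma_less_asymptotic gamma_lower in simp_all)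

end
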